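(* Let $\nu>-1/2$, $\alpha>0$, $\mu\in\mathbb{R}$ and let $X\sim\mathrm{VG}(\nu,\alpha,0,\mu)$. Then, for every odd integer $r\ge1$, $$\begin{aligned} \mathbb{E}[|X|^r]&=\frac{2^r}{\sqrt{\pi}\alpha^{r}\Gamma(\nu+1/2)}\bigg\{\sum_{k=0}^{(r-1)/2}\binom{r}{2k}\Big(\frac{\alpha\mu}{2}\Big)^{2k}\Gamma\Big(\frac{r-2k+1}{2}\Big)\Gamma\Big(\nu+\frac{r-2k+1}{2}\Big)\\ &\quad-\sum_{k=0}^{r}\binom{r}{k}(-1)^k\Big(\frac{\alpha|\mu|}{2}\Big)^k\Gamma\Big(\frac{r-k+1}{2}\Big)\Gamma\Big(\nu+\frac{r-k+1}{2}\Big)G_{\nu+r-k,\nu}(\alpha|\mu|)\bigg\}. \end{aligned}$$ Moreover, when $r=1$, $$\mathbb{E}[|X|]=\frac1\alpha\bigg[(\alpha\mu)^2\big(K_\nu(\alpha|\mu|)\mathbf{L}_{\nu-1}(\alpha|\mu|)+K_{\nu-1}(\alpha|\mu|)\mathbf{L}_\nu(\alpha|\mu|)\big)+\frac{(\alpha|\mu|)^{\nu+1}K_{\nu+1}(\alpha|\mu|)}{\sqrt{\pi}\,2^{\nu-1}\Gamma(\nu+1/2)}\bigg].$$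
   Context: $\mathrm{VG}(\nu,\alpha,\beta,\mu)$ ($\nu>-1/2$, $0\le|\beta|<\alpha$, $\mu\in\mathbb{R}$) denotes the variance-gamma distribution, with probability density function on $\mathbb{R}$ $$p(x)=\frac{(\alpha^2-\beta^2)^{\nu+1/2}}{\sqrt{\pi}(2\alpha)^\nu\Gamma(\nu+1/2)}\,\mathrm{e}^{\beta(x-\mu)}|x-\mu|^\nu K_\nu(\alpha|x-\mu|),$$ where $K_\nu$ is the modified Bessel function of the second kind. $\mathbf{L}_\nu$ is the modified Struve function of the first kind, $\mathbf{L}_\nu(x)=\frac{(x/2)^{\nu+1}}{\Gamma(3/2)\Gamma(\nu+3/2)}\,{}_1F_2(1;\tfrac32,\nu+\tfrac32;\tfrac{x^2}{4})$. Convention: $0^0=1$. For $a\ge\nu>-1/2$ and $x>0$, $$G_{a,\nu}(x)=x\big(K_\nu(x)\,\tilde t_{a-1,\nu-1}(x)+K_{\nu-1}(x)\,\tilde t_{a,\nu}(x)\big),\qquad G_{a,\nu}(0)=0,$$ where $$\tilde t_{a,\nu}(x)=\frac{x^{a+1}}{2^{a+1}\Gamma((a-\nu+3)/2)\Gamma((a+\nu+3)/2)}\,{}_1F_2\Big(1;\frac{a-\nu+3}{2},\frac{a+\nu+3}{2};\frac{x^2}{4}\Big).$$ When $\mu=0$ the right-hand side of the $r=1$ formula is understood as its limit as $\mu\to0$. *)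

theory Defs
  imports "HOL-Probability.Probability"
begin

text \<open>The modified Bessel function of the second kind for real order and argument \<open>x > 0\<close>.
  For \<open>x \<le> 0\<close> the integral diverges, so the value there is 0.\<close>

definition bessel_K :: "real \<Rightarrow> real \<Rightarrow> real" where
  "bessel_K \<nu> x = (LBINT t:{0..}. exp (- x * cosh t) * cosh (\<nu> * t))"

definition hypergeom_1F2 :: "real \<Rightarrow> real \<Rightarrow> real \<Rightarrow> real \<Rightarrow> real" where
  "hypergeom_1F2 a b c x =
     (\<Sum>n. pochhammer a n / (pochhammer b n * pochhammer c n) * x ^ n / fact n)"

definition struve_L :: "real \<Rightarrow> real \<Rightarrow> real" where
  "struve_L \<nu> x = (x / 2) powr (\<nu> + 1) / (Gamma (3 / 2) * Gamma (\<nu> + 3 / 2))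
     * hypergeom_1F2 1 (3 / 2) (\<nu> + 3 / 2) (x\<^sup>2 / 4)"

definition t_tilde :: "real \<Rightarrow> real \<Rightarrow> real \<Rightarrow> real" where
  "t_tilde a \<nu> x =
     x powr (a + 1) / (2 powr (a + 1) * Gamma ((a - \<nu> + 3) / 2) * Gamma ((a + \<nu> + 3) / 2))
     * hypergeom_1F2 1 ((a - \<nu> + 3) / 2) ((a + \<nu> + 3) / 2) (x\<^sup>2 / 4)"

definition G_fun :: "real \<Rightarrow> real \<Rightarrow> real \<Rightarrow> real" where
  "G_fun a \<nu> x =
     (if x = 0 then 0
      else x * (bessel_K \<nu> x * t_tilde (a - 1) (\<nu> - 1) x + bessel_K (\<nu> - 1) x * t_tilde a \<nu> x))"

text \<open>At the single point \<open>x = \<mu>\<close> the value below is 0, whatever the order; this is a null set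
  and does not affect the distribution.\<close>

definition VG_density :: "real \<Rightarrow> real \<Rightarrow> real \<Rightarrow> real \<Rightarrow> real \<Rightarrow> real" where
  "VG_density \<nu> \<alpha> \<beta> \<mu> x =
     (\<alpha>\<^sup>2 - \<beta>\<^sup>2) powr (\<nu> + 1 / 2) / (sqrt pi * (2 * \<alpha>) powr \<nu> * Gamma (\<nu> + 1 / 2))
     * exp (\<beta> * (x - \<mu>)) * \<bar>x - \<mu>\<bar> powr \<nu> * bessel_K \<nu> (\<alpha> * \<bar>x - \<mu>\<bar>)"

end

theory Submission
  imports Defs
begin

text \<open>Write \<open>X = \<mu> + Y / \<alpha>\<close>, where \<open>Y\<close> has a density proportional to the even function
  \<open>\<bar>y\<bar> powr \<nu> * K\<^sub>\<nu> \<bar>y\<bar>\<close>, and put \<open>m = \<alpha> * \<bar>\<mu>\<bar>\<close>. Folding the integral at 0, for odd \<open>r\<close> and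
  \<open>y > 0\<close> the factor \<open>\<bar>y + m\<bar> ^ r + \<bar>y - m\<bar> ^ r\<close> equals \<open>(y + m) ^ r + (y - m) ^ r\<close>, corrected by
  \<open>- 2 * (y - m) ^ r\<close> on \<open>y < m\<close>. Expanding both powers leaves the complete moments
  \<open>\<integral> y powr a * K\<^sub>\<nu> y\<close> over \<open>(0, \<infinity>)\<close>, which are Beta integrals after Fubini, and the truncated
  moments over \<open>(0, m)\<close>. The latter come from the fact that \<open>G\<^sub>a\<^sub>,\<^sub>\<nu>\<close> is, up to a constant, the
  antiderivative of \<open>x powr a * K\<^sub>\<nu> x\<close> vanishing at 0. For \<open>r = 1\<close> the factor is \<open>2 * max y m\<close>, and
  the tail integral is elementary because \<open>(x powr (\<nu> + 1) * K\<^sub>\<nu>\<^sub>+\<^sub>1 x)' = - x powr (\<nu> + 1) * K\<^sub>\<nu> x\<close>.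
  The expectation is Lipschitz in \<open>\<mu>\<close>, which gives the limit at \<open>\<mu> = 0\<close>.\<close>

section \<open>Beta integrals and the modified Bessel function\<close>

lemma has_bochner_integral_mono:
  fixes f g :: "'a \<Rightarrow> real"
  assumes "has_bochner_integral M f a" "has_bochner_integral M g b"
    and "\<And>x. x \<in> space M \<Longrightarrow> f x \<le> g x"
  shows "a \<le> b"
  using integral_mono[of M f g] assms by (auto simp: has_bochner_integral_iff)

text \<open>For nonnegative measurable integrands the gauge and Lebesgue integrals agree; this
  carries gauge-form substitutions and the fundamental theorem of calculus over to Bochner
  integrals.\<close>

lemma has_bochner_integral_of_has_integral_nonneg:
  fixes f :: "real \<Rightarrow> real"
  assumes "(f has_integral I) S" and "\<And>x. x \<in> S \<Longrightarrow> 0 \<le> f x"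
    and [measurable]: "(\<lambda>x. indicator S x * f x) \<in> borel_measurable borel"
  shows "has_bochner_integral lborel (\<lambda>x. indicator S x * f x) I"
proof (rule has_bochner_integral_nn_integral)
  have "((\<lambda>x. indicator S x * f x) has_integral I) UNIV"
    using assms(1) by (subst (asm) has_integral_restrict_UNIV[symmetric])
      (simp add: indicator_def of_bool_def if_distrib[of "\<lambda>c. c * _"] cong: if_cong)
  then show "(\<integral>\<^sup>+x. ennreal (indicator S x * f x) \<partial>lborel) = ennreal I"
    using nn_integral_has_integral_lebesgue[of UNIV "\<lambda>x. indicator S x * f x" I] assms(2)
    by (auto simp: indicator_def)
  show "0 \<le> I"
    using assms(1,2) by (rule has_integral_nonneg)
qed (use assms(2) in \<open>auto split: split_indicator\<close>)

lemma borel_measurable_cosh [measurable (raw)]: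
  fixes f :: "'a \<Rightarrow> real"
  assumes "f \<in> borel_measurable M"
  shows "(\<lambda>x. cosh (f x)) \<in> borel_measurable M"
  using assms unfolding cosh_field_def by measurable

text \<open>The substitution \<open>u = exp t / (exp t + exp (- t))\<close> maps the real line onto
  \<open>(0, 1)\<close> and evaluates the integral of \<open>exp (\<nu> * t) / cosh t powr b\<close>
  over the whole line. Averaging with the reflected integrand produces
  \<open>cosh (\<nu> * t)\<close>, and evenness halves the result.\<close>

lemma has_bochner_integral_cosh_over_cosh_powr:
  fixes \<nu> b :: real
  assumes "\<bar>\<nu>\<bar> < b"
  shows "has_bochner_integral lborel (\<lambda>t. indicator {0..} t * (cosh (\<nu> * t) / cosh t powr b))
           (2 powr (b - 2) * Beta ((b + \<nu>) / 2) ((b - \<nu>) / 2))"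
proof -
  define p q where "p = (b + \<nu>) / 2" and "q = (b - \<nu>) / 2"
  have pq: "p > 0" "q > 0" "p + q = b" "p - q = \<nu>"
    using assms by (auto simp: p_def q_def field_simps)
  \<comment> \<open>This substitution turns \<open>exp (\<nu> * t) / cosh t powr b\<close> into the Beta integrand.\<close>
  define g :: "real \<Rightarrow> real" where "g t = exp t / (exp t + exp (- t))" for t
  define f :: "real \<Rightarrow> real" where "f u = u powr (p - 1) * (1 - u) powr (q - 1)" for u
  have sum_pos: "exp t + exp (- t) > 0" for t :: real by (simp add: add_pos_pos)
  have g_pos: "g t > 0" for t using sum_pos by (simp add: g_def)
  have g1: "1 - g t = exp (- t) / (exp t + exp (- t))" for t
    using sum_pos[of t] by (simp add: g_def field_simps)
  have g1_pos: "1 - g t > 0" for t unfolding g1 using sum_pos[of t] by simp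
  have deriv_g: "(g has_field_derivative 2 * (g t * (1 - g t))) (at t within UNIV)" for t
    unfolding g1 unfolding g_def
    by (rule derivative_eq_intros refl | use sum_pos[of t] in \<open>simp add: field_simps flip: exp_add\<close>)+
  \<comment> \<open>The odds \<open>g t / (1 - g t)\<close> equal \<open>exp (2 * t)\<close>; this
    explains the inverse here and the injectivity below.\<close>
  have gln: "g (ln (u / (1 - u)) / 2) = u" if u: "0 < u" "u < 1" for u
  proof -
    have "g t = 1 / (1 + exp (- (2 * t)))" for t
      using sum_pos[of t] add_pos_pos[OF zero_less_one exp_gt_zero[of "- (2 * t)"]]
      by (simp add: g_def frac_eq_eq ring_distribs flip: exp_add)
    then show ?thesis
      using u by (simp add: exp_minus field_simps)
  qed
  have range_g: "range g = {0<..<1}"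
  proof safe
    show "g t \<in> {0<..<1}" for t using g_pos[of t] g1_pos[of t] by simp
    show "u \<in> range g" if "u \<in> {0<..<1}" for u
      using that gln[of u] by (metis greaterThanLessThan_iff rangeI)
  qed
  have inj_g: "inj g"
  proof (rule injI)
    fix s t assume "g s = g t"
    then have "g s / (1 - g s) = g t / (1 - g t)" by simp
    moreover have "g t / (1 - g t) = exp (2 * t)" for t
      using sum_pos[of t] by (simp add: g1 g_def exp_minus field_simps flip: exp_add)
    ultimately show "s = t" by simp
  qed
  have "(f has_integral Beta p q) {0<..<1}"
    using has_integral_Beta_real[OF pq(1,2)] by (simp add: f_def[abs_def] has_integral_Icc_iff_Ioo)
  then have "f absolutely_integrable_on range g \<and> integral (range g) f = Beta p q"
    unfolding range_g
    by (auto intro!: nonnegative_absolutely_integrable_1 simp: f_def has_integral_iff)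
  then have *: "(\<lambda>t. \<bar>2 * (g t * (1 - g t))\<bar> * f (g t)) absolutely_integrable_on UNIV \<and>
             integral UNIV (\<lambda>t. \<bar>2 * (g t * (1 - g t))\<bar> * f (g t)) = Beta p q"
    by (subst has_absolute_integral_change_of_variables_1'[OF _ deriv_g inj_g]) auto
  \<comment> \<open>The Jacobian \<open>2 * u * (1 - u)\<close> raises both Beta exponents by one.
    As \<open>g t\<close> and \<open>1 - g t\<close> are \<open>exp t\<close> and
    \<open>exp (- t)\<close> over \<open>2 * cosh t\<close>, the numerators combine to order
    \<open>p - q = \<nu>\<close> and the denominators to order \<open>p + q = b\<close>.\<close>
  have eq: "\<bar>2 * (g t * (1 - g t))\<bar> * f (g t) = 2 powr (1 - b) * (exp (\<nu> * t) / cosh t powr b)" for t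
  proof -
    have cosh_double_eq: "2 * cosh t = exp t + exp (- t)" by (simp add: cosh_field_def)
    have g2: "g t = exp t / (2 * cosh t)" "1 - g t = exp (- t) / (2 * cosh t)"
      unfolding g1 by (simp_all add: g_def cosh_double_eq)
    have "\<bar>2 * (g t * (1 - g t))\<bar> * f (g t) = 2 * (g t powr 1 * g t powr (p - 1)) * ((1 - g t) powr 1 * (1 - g t) powr (q - 1))"
      using g_pos[of t] g1_pos[of t] by (simp add: f_def)
    also have "\<dots> = 2 * g t powr p * (1 - g t) powr q"
      unfolding powr_add[symmetric] by simp
    also have "\<dots> = 2 * ((exp t powr p * exp (- t) powr q) / ((2 * cosh t) powr p * (2 * cosh t) powr q))"
      unfolding g2(2) unfolding g2(1) by (simp add: powr_divide)
    also have "\<dots> = 2 * (exp (\<nu> * t) / (2 * cosh t) powr b)"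
    proof -
      have "exp t powr p * exp (- t) powr q = exp ((p - q) * t)"
        by (simp add: powr_def left_diff_distrib flip: exp_add)
      then show ?thesis by (simp add: pq flip: powr_add)
    qed
    also have "\<dots> = 2 powr (1 - b) * (exp (\<nu> * t) / cosh t powr b)"
      by (simp add: powr_mult powr_diff)
    finally show ?thesis .
  qed
  have h1: "((\<lambda>t. 2 powr (1 - b) * (exp (\<nu> * t) / cosh t powr b)) has_integral Beta p q) UNIV"
    using * unfolding eq absolutely_integrable_on_def has_integral_iff by blast
  then have "((\<lambda>t. 2 powr (b - 1) * (2 powr (1 - b) * (exp (\<nu> * t) / cosh t powr b))) has_integral 2 powr (b - 1) * Beta p q) UNIV"
    by (rule has_integral_mult_right)
  then have h1: "((\<lambda>t. exp (\<nu> * t) / cosh t powr b) has_integral 2 powr (b - 1) * Beta p q) UNIV"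
    by (simp add: mult.assoc[symmetric] powr_add[symmetric])
  have h: "has_bochner_integral lborel (\<lambda>t. exp (\<nu> * t) / cosh t powr b) (2 powr (b - 1) * Beta p q)"
    using has_bochner_integral_of_has_integral_nonneg[OF h1] by simp
  have h': "has_bochner_integral lborel (\<lambda>t. exp (- (\<nu> * t)) / cosh t powr b) (2 powr (b - 1) * Beta p q)"
    by (subst lborel_has_bochner_integral_real_affine_iff[where c="-1" and t=0]) (simp_all add: h)
  have hc: "has_bochner_integral lborel (\<lambda>t. cosh (\<nu> * t) / cosh t powr b) (2 powr (b - 1) * Beta p q)"
  proof -
    have *: "cosh (\<nu> * t) / cosh t powr b = 1 / 2 * (exp (\<nu> * t) / cosh t powr b + exp (- (\<nu> * t)) / cosh t powr b)" for t
      unfolding cosh_field_def[of "\<nu> * t"] by (simp add: field_simps)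
    show ?thesis
      unfolding * using has_bochner_integral_mult_right[of "1/2", OF has_bochner_integral_add[OF h h']]
      by (simp add: mult.commute)
  qed
  define I where "I = (\<integral>t. indicator {0..} t *\<^sub>R (cosh (\<nu> * t) / cosh t powr b) \<partial>lborel)"
  have I: "has_bochner_integral lborel (\<lambda>t. indicator {0..} t *\<^sub>R (cosh (\<nu> * t) / cosh t powr b)) I"
    unfolding has_bochner_integral_iff I_def
    by (intro conjI refl integrable_mult_indicator integrable.intros[OF hc]) simp
  have "has_bochner_integral lborel (\<lambda>t. cosh (\<nu> * t) / cosh t powr b) (2 *\<^sub>R I)"
    using I by (rule has_bochner_integral_even_function) simp
  with hc have "2 * I = 2 powr (b - 1) * Beta p q"
    by (auto dest: has_bochner_integral_eq)
  moreover have "2 powr (b - 1) = 2 * 2 powr (b - 2)"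
    by (simp add: powr_diff)
  ultimately have "I = 2 powr (b - 2) * Beta p q" by simp
  with I show ?thesis unfolding p_def q_def real_scaleR_def by simp
qed

section \<open>Power bounds and integrability for the Bessel integral\<close>

text \<open>This is \<open>ln u \<le> u\<close> at \<open>u = y / b\<close>, multiplied by
  \<open>b\<close> and exponentiated.\<close>

lemma exp_minus_le_powr:
  fixes b y :: real
  assumes "b > 0" "y > 0"
  shows "exp (- y) \<le> b powr b * y powr (- b)"
proof -
  have "ln (y / b) \<le> y / b"
    using ln_le_minus_one[of "y / b"] assms by simp
  then have "b * ln y \<le> b * ln b + y"
    using assms by (simp add: ln_div field_simps)
  then show ?thesis
    using assms by (simp add: powr_def flip: exp_add)
qed

text \<open>Using \<open>exp_minus_le_powr\<close> at \<open>y = x * cosh t\<close> separates the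
  variables: a power of \<open>x\<close> times a function of \<open>t\<close> that is integrable as
  soon as \<open>b\<close> exceeds \<open>\<bar>\<nu>\<bar>\<close>.\<close>

lemma bessel_K_kernel_le:
  fixes \<nu> b x t :: real
  assumes "b > 0" "x > 0"
  shows "exp (- x * cosh t) * cosh (\<nu> * t) \<le> b powr b * x powr (- b) * (cosh (\<nu> * t) / cosh t powr b)"
proof -
  have "exp (- (x * cosh t)) \<le> b powr b * (x * cosh t) powr (- b)"
    using assms by (intro exp_minus_le_powr) auto
  then have "exp (- (x * cosh t)) * cosh (\<nu> * t) \<le> b powr b * (x * cosh t) powr (- b) * cosh (\<nu> * t)"
    by (rule mult_right_mono) simp
  then show ?thesis
    using assms by (simp add: powr_mult powr_minus field_simps)
qed

lemma has_bochner_integral_bessel_K: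
  assumes "x > 0"
  shows "has_bochner_integral lborel (\<lambda>t. indicator {0..} t * (exp (- x * cosh t) * cosh (\<nu> * t))) (bessel_K \<nu> x)"
proof -
  define b where "b = \<bar>\<nu>\<bar> + 1"
  have b: "b > 0" "\<bar>\<nu>\<bar> < b" by (auto simp: b_def)
  have "integrable lborel (\<lambda>t. b powr b * x powr (- b) * (indicator {0..} t * (cosh (\<nu> * t) / cosh t powr b)))"
    using has_bochner_integral_cosh_over_cosh_powr[OF b(2)]
    by (intro integrable_mult_right) (simp add: has_bochner_integral_iff)
  then have "integrable lborel (\<lambda>t. indicator {0..} t * (exp (- x * cosh t) * cosh (\<nu> * t)))"
    by (rule Bochner_Integration.integrable_bound)
      (use bessel_K_kernel_le[OF b(1) assms, of _ \<nu>] in \<open>auto split: split_indicator\<close>)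
  then show ?thesis
    by (simp add: has_bochner_integral_iff bessel_K_def set_lebesgue_integral_def)
qed

lemma bessel_K_nonneg: "bessel_K \<nu> x \<ge> 0"
  unfolding bessel_K_def set_lebesgue_integral_def
  by (rule Bochner_Integration.integral_nonneg) (auto simp: indicator_def)

lemma bessel_K_minus [simp]: "bessel_K (- \<nu>) x = bessel_K \<nu> x"
  by (simp add: bessel_K_def)

lemma bessel_K_measurable [measurable]: "bessel_K \<nu> \<in> borel_measurable borel"
  unfolding bessel_K_def[abs_def] set_lebesgue_integral_def by measurable

text \<open>Integrate \<open>bessel_K_kernel_le\<close> over \<open>t\<close>. The exponent
  \<open>b\<close> stays free because the limit at 0 takes it close to
  \<open>\<bar>\<nu>\<bar>\<close> and the limit at infinity takes it large.\<close>

lemma bessel_K_le_powr: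
  assumes "\<bar>\<nu>\<bar> < b"
  obtains C where "C \<ge> 0" "\<And>x. x > 0 \<Longrightarrow> bessel_K \<nu> x \<le> C * x powr (- b)"
proof
  have b: "b > 0" using assms by linarith
  define I where "I = 2 powr (b - 2) * Beta ((b + \<nu>) / 2) ((b - \<nu>) / 2)"
  have I: "has_bochner_integral lborel (\<lambda>t. indicator {0..} t * (cosh (\<nu> * t) / cosh t powr b)) I"
    using has_bochner_integral_cosh_over_cosh_powr[OF assms] by (simp add: I_def)
  have "0 \<le> I"
    using has_bochner_integral_integral_eq[OF I, symmetric]
    by (simp add: Bochner_Integration.integral_nonneg indicator_def)
  then show "b powr b * I \<ge> 0" by simp
  fix x :: real assume x: "x > 0"
  have "bessel_K \<nu> x \<le> (b powr b * x powr (- b)) * I"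
    using has_bochner_integral_bessel_K[OF x, of \<nu>] has_bochner_integral_mult_right[of "b powr b * x powr (- b)", OF I]
    by (rule has_bochner_integral_mono)
       (use bessel_K_kernel_le[OF b x, of _ \<nu>] in \<open>auto split: split_indicator\<close>)
  then show "bessel_K \<nu> x \<le> b powr b * I * x powr (- b)"
    by (simp add: mult_ac)
qed

section \<open>Derivative and three-term recurrence of the Bessel function\<close>

text \<open>Together with its \<open>sinh\<close> companion, this turns the extra hyperbolic factor
  left by a differentiation into kernels of the neighbouring orders.\<close>

lemma cosh_mult_cosh: "cosh t * cosh (\<nu> * t) = (cosh ((\<nu> + 1) * t) + cosh ((\<nu> - 1) * t)) / 2"
  for t :: real
  by (simp add: ring_distribs left_diff_distrib cosh_add cosh_diff mult.commute)

lemma sinh_mult_sinh: "sinh t * sinh (\<nu> * t) = (cosh ((\<nu> + 1) * t) - cosh ((\<nu> - 1) * t)) / 2"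
  for t :: real
  by (simp add: ring_distribs left_diff_distrib cosh_add cosh_diff mult.commute)

text \<open>Up to sign the integrand is the derivative of the Bessel kernel in \<open>x\<close>.
  Taken at a smaller argument, it also serves as the majorant for differentiating under the integral
  sign.\<close>

lemma has_bochner_integral_cosh_bessel_kernel:
  assumes "x > 0"
  shows "has_bochner_integral lborel
           (\<lambda>t. indicator {0..} t * (cosh t * exp (- x * cosh t) * cosh (\<nu> * t)))
           ((bessel_K (\<nu> + 1) x + bessel_K (\<nu> - 1) x) / 2)"
proof -
  let ?k = "\<lambda>\<nu> t. indicator {0..} t * (exp (- x * cosh t) * cosh (\<nu> * t))"
  have "(\<lambda>t. indicator {0..} t * (cosh t * exp (- x * cosh t) * cosh (\<nu> * t))) =
      (\<lambda>t. (?k (\<nu> + 1) t + ?k (\<nu> - 1) t) / 2)"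
  proof
    fix t
    have "indicator {0..} t * (cosh t * exp (- x * cosh t) * cosh (\<nu> * t)) =
        indicator {0..} t * (exp (- x * cosh t) * (cosh t * cosh (\<nu> * t)))"
      by (simp only: ac_simps)
    also have "\<dots> = (?k (\<nu> + 1) t + ?k (\<nu> - 1) t) / 2"
      unfolding cosh_mult_cosh by (simp only: distrib_left times_divide_eq_right)
    finally show "indicator {0..} t * (cosh t * exp (- x * cosh t) * cosh (\<nu> * t)) = \<dots>" .
  qed
  then show ?thesis
    by (simp only:) (intro has_bochner_integral_divide has_bochner_integral_add has_bochner_integral_bessel_K assms; simp)
qed

text \<open>Differentiation under the integral sign: along any sequence tending to \<open>x\<close>
  the difference quotients of the kernel converge pointwise, and dominated convergence
  applies.\<close>

lemma has_real_derivative_bessel_K: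
  assumes x: "x > 0"
  shows "(bessel_K \<nu> has_real_derivative - (bessel_K (\<nu> + 1) x + bessel_K (\<nu> - 1) x) / 2) (at x)"
proof -
  \<comment> \<open>Staying to the right of \<open>x / 2\<close> gives all difference quotients a
    common integrable majorant, the mean value bound for the slope of
    \<open>exp (- y * cosh t)\<close> on \<open>{d<..}\<close>.\<close>
  define d where "d = x / 2"
  have d: "d > 0" "d < x" using x by (auto simp: d_def)
  define D where "D = - (bessel_K (\<nu> + 1) x + bessel_K (\<nu> - 1) x) / 2"
  let ?w = "\<lambda>t. indicator {0..} t * (cosh t * exp (- d * cosh t) * cosh (\<nu> * t))"
  let ?f = "\<lambda>t. indicator {0..} t * (- (cosh t * exp (- x * cosh t) * cosh (\<nu> * t)))"
  have f: "has_bochner_integral lborel ?f D"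
    using has_bochner_integral_minus[OF has_bochner_integral_cosh_bessel_kernel[OF x, of \<nu>]]
    by (simp add: D_def minus_divide_left)
  have "((\<lambda>y. (bessel_K \<nu> y - bessel_K \<nu> x) / (y - x)) \<longlongrightarrow> D) (at x within {d<..})"
    unfolding tendsto_at_iff_sequentially
  proof (intro allI impI)
    fix X assume X: "\<forall>i. X i \<in> {d<..} - {x}" and lim: "X \<longlonglongrightarrow> x"
    define s where "s n t = indicator {0..} t * ((exp (- X n * cosh t) - exp (- x * cosh t)) / (X n - x) * cosh (\<nu> * t))" for n t
    have Xpos: "X n > 0" for n using X d by (auto intro: less_trans)
    have s: "has_bochner_integral lborel (s n) ((bessel_K \<nu> (X n) - bessel_K \<nu> x) / (X n - x))" for n
    proof -
      have "has_bochner_integral lborel (\<lambda>t. (indicator {0..} t * (exp (- X n * cosh t) * cosh (\<nu> * t))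
              - indicator {0..} t * (exp (- x * cosh t) * cosh (\<nu> * t))) / (X n - x))
              ((bessel_K \<nu> (X n) - bessel_K \<nu> x) / (X n - x))"
        by (intro has_bochner_integral_divide has_bochner_integral_diff has_bochner_integral_bessel_K x Xpos)
      then show ?thesis
        by (rule has_bochner_integral_cong[THEN iffD1, rotated 3]) (simp_all add: s_def algebra_simps)
    qed
    have "(\<lambda>n. integral\<^sup>L lborel (s n)) \<longlonglongrightarrow> integral\<^sup>L lborel ?f"
    proof (rule integral_dominated_convergence[where w = ?w])
      show "?f \<in> borel_measurable lborel" by measurable
      show "s n \<in> borel_measurable lborel" for n unfolding s_def by measurable
      show "integrable lborel ?w"
        using has_bochner_integral_cosh_bessel_kernel[OF d(1), of \<nu>] by (simp add: has_bochner_integral_iff)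
      have "(\<lambda>n. s n t) \<longlonglongrightarrow> ?f t" for t
      proof -
        have "((\<lambda>y. exp (- y * cosh t)) has_real_derivative - cosh t * exp (- x * cosh t)) (at x within {d<..})"
          by (auto intro!: derivative_eq_intros)
        then have "((\<lambda>y. (exp (- y * cosh t) - exp (- x * cosh t)) / (y - x)) \<longlongrightarrow> - cosh t * exp (- x * cosh t)) (at x within {d<..})"
          by (simp add: has_field_derivative_iff)
        then have "(\<lambda>n. (exp (- X n * cosh t) - exp (- x * cosh t)) / (X n - x)) \<longlonglongrightarrow> - cosh t * exp (- x * cosh t)"
          using X lim unfolding tendsto_at_iff_sequentially by (auto simp: o_def)
        then have "(\<lambda>n. s n t) \<longlonglongrightarrow> indicator {0..} t * (- cosh t * exp (- x * cosh t) * cosh (\<nu> * t))"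
          unfolding s_def by (intro tendsto_intros)
        then show ?thesis by simp
      qed
      then show "AE t in lborel. (\<lambda>n. s n t) \<longlonglongrightarrow> ?f t" by simp
      have "norm (s n t) \<le> ?w t" for n t
      proof -
        have "norm (exp (- X n * cosh t) - exp (- x * cosh t)) \<le> (cosh t * exp (- d * cosh t)) * norm (X n - x)"
          by (rule field_differentiable_bound[of "{d<..}" _ "\<lambda>y. - cosh t * exp (- y * cosh t)"])
            (use X d in \<open>auto intro!: derivative_eq_intros simp: abs_mult\<close>)
        moreover have "X n \<noteq> x" using X by auto
        ultimately have "\<bar>(exp (- X n * cosh t) - exp (- x * cosh t)) / (X n - x)\<bar> \<le> cosh t * exp (- d * cosh t)"
          by (simp add: field_simps)
        then have "\<bar>(exp (- X n * cosh t) - exp (- x * cosh t)) / (X n - x)\<bar> * cosh (\<nu> * t) \<le> cosh t * exp (- d * cosh t) * cosh (\<nu> * t)"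
          by (rule mult_right_mono) simp
        then show ?thesis
          by (simp add: s_def abs_mult split: split_indicator)
      qed
      then show "AE t in lborel. norm (s n t) \<le> ?w t" for n by simp
    qed
    then show "((\<lambda>y. (bessel_K \<nu> y - bessel_K \<nu> x) / (y - x)) \<circ> X) \<longlonglongrightarrow> D"
      using s f by (simp add: has_bochner_integral_iff o_def)
  qed
  then have "(bessel_K \<nu> has_real_derivative D) (at x within {d<..})"
    by (simp add: has_field_derivative_iff)
  then show ?thesis
    using d by (simp add: at_within_open[of x "{d<..}"] D_def)
qed

text \<open>Supplies the boundary term at infinity in \<open>bessel_K_recurrence\<close>. As
  \<open>cosh t \<ge> exp t / 2\<close>, the first factor is at most a multiple of
  \<open>exp (- b * t)\<close>; with \<open>b = \<bar>\<nu>\<bar> + 1\<close> this beats the growth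
  \<open>exp (\<bar>\<nu>\<bar> * t)\<close> of \<open>sinh\<close> by a factor
  \<open>exp (- t)\<close>.\<close>

lemma exp_cosh_sinh_tendsto_0:
  fixes x \<nu> :: real
  assumes "x > 0"
  shows "((\<lambda>t. exp (- x * cosh t) * sinh (\<nu> * t)) \<longlongrightarrow> 0) at_top"
proof -
  define b where "b = \<bar>\<nu>\<bar> + 1"
  have b: "b > 0" by (simp add: b_def)
  define C where "C = b powr b * (x / 2) powr (- b)"
  have "norm (exp (- x * cosh t) * sinh (\<nu> * t)) \<le> C * exp (- t)" if "t \<ge> 0" for t
  proof -
    have "exp (- (x * cosh t)) \<le> exp (- (x / 2 * exp t))"
      using assms by (simp add: cosh_field_def)
    also have "\<dots> \<le> b powr b * (x / 2 * exp t) powr (- b)"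
      using assms b by (intro exp_minus_le_powr) auto
    also have "\<dots> = C * exp (- b * t)"
      using assms powr_mult[of "x / 2" "exp t" "- b"] by (simp add: C_def exp_powr_real mult.commute)
    finally have 1: "exp (- (x * cosh t)) \<le> C * exp (- b * t)" .
    have "\<bar>sinh (\<nu> * t)\<bar> = sinh \<bar>\<nu> * t\<bar>"
      by (simp add: abs_if)
    also have "\<dots> \<le> exp \<bar>\<nu> * t\<bar>"
      unfolding sinh_field_def using exp_gt_zero[of "\<bar>\<nu> * t\<bar>"] exp_gt_zero[of "- \<bar>\<nu> * t\<bar>"]
      by (simp add: field_simps del: exp_gt_zero)
    finally have "\<bar>sinh (\<nu> * t)\<bar> \<le> exp (\<bar>\<nu>\<bar> * t)"
      using that by (simp add: abs_mult)
    then have "exp (- (x * cosh t)) * \<bar>sinh (\<nu> * t)\<bar> \<le> C * exp (- b * t) * exp (\<bar>\<nu>\<bar> * t)"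
      using 1 by (intro mult_mono) (auto simp: C_def)
    also have "\<dots> = C * exp (- t)"
      by (simp add: b_def algebra_simps flip: exp_add)
    finally show ?thesis by (simp add: abs_mult)
  qed
  then have "eventually (\<lambda>t. norm (exp (- x * cosh t) * sinh (\<nu> * t)) \<le> C * exp (- t)) at_top"
    using eventually_ge_at_top[of 0] by (rule eventually_mono[rotated])
  moreover have "((\<lambda>t. C * exp (- t)) \<longlongrightarrow> 0) at_top"
    by (intro tendsto_mult_right_zero filterlim_compose[OF exp_at_bot] filterlim_uminus_at_bot_at_top)
  ultimately show ?thesis
    by (rule Lim_null_comparison)
qed

text \<open>The function \<open>F t = exp (- x * cosh t) * sinh (\<nu> * t)\<close> vanishes at 0
  and at infinity, so its derivative integrates to 0. By \<open>sinh_mult_sinh\<close> that integral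
  is a combination of the three Bessel functions.\<close>

lemma bessel_K_recurrence:
  assumes x: "x > 0"
  shows "bessel_K (\<nu> + 1) x = bessel_K (\<nu> - 1) x + 2 * \<nu> / x * bessel_K \<nu> x"
proof -
  define F where "F t = exp (- x * cosh t) * sinh (\<nu> * t)" for t
  define f where "f t = \<nu> * (exp (- x * cosh t) * cosh (\<nu> * t)) - x * exp (- x * cosh t) * (sinh t * sinh (\<nu> * t))" for t
  have "has_bochner_integral lborel
      (\<lambda>t. \<nu> * (indicator {0..} t * (exp (- x * cosh t) * cosh (\<nu> * t)))
         - x / 2 * (indicator {0..} t * (exp (- x * cosh t) * cosh ((\<nu> + 1) * t))
            - indicator {0..} t * (exp (- x * cosh t) * cosh ((\<nu> - 1) * t))))
      (\<nu> * bessel_K \<nu> x - x / 2 * (bessel_K (\<nu> + 1) x - bessel_K (\<nu> - 1) x))"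
    by (intro has_bochner_integral_diff has_bochner_integral_mult_right has_bochner_integral_bessel_K x)
  then have f: "has_bochner_integral lborel (\<lambda>t. indicator {0..} t *\<^sub>R f t)
      (\<nu> * bessel_K \<nu> x - x / 2 * (bessel_K (\<nu> + 1) x - bessel_K (\<nu> - 1) x))"
    by (rule has_bochner_integral_cong[THEN iffD1, rotated 3])
      (simp_all only: f_def sinh_mult_sinh, simp_all add: field_simps split: split_indicator)
  \<comment> \<open>The interval integral below runs over the open half-line, so the null set
    \<open>{0}\<close> is removed first.\<close>
  then have "has_bochner_integral lborel (\<lambda>t. indicator {0<..} t *\<^sub>R f t)
      (\<nu> * bessel_K \<nu> x - x / 2 * (bessel_K (\<nu> + 1) x - bessel_K (\<nu> - 1) x))"
    by (rule has_bochner_integral_discrete_difference[where X="{0}", THEN iffD1, rotated 4])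
       (auto split: split_indicator)
  moreover have "(LBINT t=0..\<infinity>. f t) = 0 - 0"
  proof (rule interval_integral_FTC_integrable[where F=F])
    show "(F has_vector_derivative f t) (at t)" for t
      unfolding has_real_derivative_iff_has_vector_derivative[symmetric] F_def f_def
      by (auto intro!: derivative_eq_intros simp: algebra_simps)
    show "isCont f t" for t
      unfolding f_def by (intro continuous_intros)
    show "((F \<circ> real_of_ereal) \<longlongrightarrow> 0) (at_right 0)"
    proof -
      have "(F \<longlongrightarrow> F 0) (at_right 0)"
        unfolding F_def by (intro tendsto_intros) 
      then show ?thesis by (simp add: zero_ereal_def ereal_tendsto_simps F_def)
    qed
    show "((F \<circ> real_of_ereal) \<longlongrightarrow> 0) (at_left \<infinity>)"
      using exp_cosh_sinh_tendsto_0[OF x, of \<nu>] by (simp add: ereal_tendsto_simps F_def[abs_def])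
    have "einterval 0 \<infinity> = {0<..}" by (auto simp: einterval_def)
    with calculation show "set_integrable lborel (einterval 0 \<infinity>) f"
      by (simp add: set_integrable_def has_bochner_integral_iff)
  qed simp
  ultimately have "\<nu> * bessel_K \<nu> x - x / 2 * (bessel_K (\<nu> + 1) x - bessel_K (\<nu> - 1) x) = 0"
    by (simp add: interval_lebesgue_integral_0_infty set_lebesgue_integral_def has_bochner_integral_iff)
  then show ?thesis using x by (simp add: field_simps)
qed

text \<open>After the product rule, eliminating \<open>bessel_K (\<nu> + 1) x\<close> by the
  recurrence cancels every term with \<open>bessel_K \<nu> x\<close>.\<close>

lemma has_real_derivative_powr_bessel_K:
  assumes x: "x > 0"
  shows "((\<lambda>x. x powr \<nu> * bessel_K \<nu> x) has_real_derivative - (x powr \<nu> * bessel_K (\<nu> - 1) x)) (at x)"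
proof -
  have "((\<lambda>x. x powr \<nu> * bessel_K \<nu> x) has_real_derivative
      \<nu> * x powr (\<nu> - 1) * bessel_K \<nu> x + - (bessel_K (\<nu> + 1) x + bessel_K (\<nu> - 1) x) / 2 * x powr \<nu>) (at x)"
    by (intro DERIV_mult has_real_derivative_bessel_K has_real_derivative_powr x)
  moreover have "x powr \<nu> = x * x powr (\<nu> - 1)" using x by (simp add: powr_diff)
  moreover have "\<nu> * x powr (\<nu> - 1) * bessel_K \<nu> x + - (bessel_K (\<nu> + 1) x + bessel_K (\<nu> - 1) x) / 2 * x powr \<nu>
      = - (x powr \<nu> * bessel_K (\<nu> - 1) x)"
    unfolding calculation(2) bessel_K_recurrence[OF x] using x by (simp add: field_simps)
  ultimately show ?thesis by simp
qed

section \<open>Mellin transform of the Bessel function\<close>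

text \<open>The Gamma integral under \<open>t = c * y\<close>, kept as an \<open>nn_integral\<close>
  because it becomes the inner integral after a Tonelli exchange.\<close>

lemma nn_integral_Gamma_scaled:
  fixes c s :: real
  assumes "c > 0" "s > 0"
  shows "(\<integral>\<^sup>+y. ennreal (indicator {0<..} y * (y powr (s - 1) * exp (- y * c))) \<partial>lborel) = ennreal (Gamma s / c powr s)"
proof -
  have "ennreal (Gamma s) = (\<integral>\<^sup>+t. ennreal (indicator {0..} t * t powr (s - 1) / exp t) \<partial>lborel)"
    by (rule Gamma_conv_nn_integral_real) fact
  also have "\<dots> = \<bar>c\<bar> * (\<integral>\<^sup>+y. ennreal (indicator {0..} (0 + c * y) * (0 + c * y) powr (s - 1) / exp (0 + c * y)) \<partial>lborel)"
    by (rule nn_integral_real_affine) (use assms in auto)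
  also have "(\<integral>\<^sup>+y. ennreal (indicator {0..} (0 + c * y) * (0 + c * y) powr (s - 1) / exp (0 + c * y)) \<partial>lborel) =
     (\<integral>\<^sup>+y. ennreal (c powr (s - 1)) * ennreal (indicator {0<..} y * (y powr (s - 1) * exp (- y * c))) \<partial>lborel)"
    by (rule nn_integral_cong_AE)
       (use AE_lborel_singleton[of 0] assms in \<open>auto elim!: eventually_mono simp: powr_mult exp_minus field_simps
         zero_le_mult_iff ennreal_mult[symmetric] split: split_indicator\<close>)
  also have "\<bar>c\<bar> * \<dots> = ennreal (c powr s) * (\<integral>\<^sup>+y. ennreal (indicator {0<..} y * (y powr (s - 1) * exp (- y * c))) \<partial>lborel)"
    using assms by (subst nn_integral_cmult) (auto simp: mult.assoc[symmetric] ennreal_mult[symmetric] powr_diff)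
  finally have "ennreal (1 / c powr s) * ennreal (Gamma s) = ennreal (1 / c powr s) * (ennreal (c powr s) *
      (\<integral>\<^sup>+y. ennreal (indicator {0<..} y * (y powr (s - 1) * exp (- y * c))) \<partial>lborel))"
    by simp
  then show ?thesis
    using assms by (simp add: mult.assoc[symmetric] ennreal_mult[symmetric])
qed

text \<open>Insert the integral representation of \<open>bessel_K\<close> and exchange the order,
  all terms being nonnegative. The inner integral is
  \<open>Gamma (a + 1) / cosh t powr (a + 1)\<close>, and the outer one is the Beta integral with
  \<open>b = a + 1\<close>.\<close>

lemma has_bochner_integral_powr_bessel_K:
  fixes \<nu> a :: real
  assumes a: "\<bar>\<nu>\<bar> < a + 1"
  shows "has_bochner_integral lborel (\<lambda>y. indicator {0<..} y * (y powr a * bessel_K \<nu> y))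
           (2 powr (a - 1) * Gamma ((a + \<nu> + 1) / 2) * Gamma ((a - \<nu> + 1) / 2))"
proof (rule has_bochner_integral_nn_integral)
  let ?k = "\<lambda>y t. indicator {0<..} y * y powr a * (indicator {0..} t * (exp (- y * cosh t) * cosh (\<nu> * t)))"
  have "(\<integral>\<^sup>+y. ennreal (indicator {0<..} y * (y powr a * bessel_K \<nu> y)) \<partial>lborel)
      = (\<integral>\<^sup>+y. (\<integral>\<^sup>+t. ennreal (?k y t) \<partial>lborel) \<partial>lborel)"
  proof (intro nn_integral_cong)
    fix y :: real
    show "ennreal (indicator {0<..} y * (y powr a * bessel_K \<nu> y)) = (\<integral>\<^sup>+t. ennreal (?k y t) \<partial>lborel)"
    proof (cases "y > 0")
      case True
      have "has_bochner_integral lborel (?k y) (indicator {0<..} y * y powr a * bessel_K \<nu> y)"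
        by (intro has_bochner_integral_mult_right has_bochner_integral_bessel_K True)
      then show ?thesis
        by (subst nn_integral_eq_integral)
           (auto simp: has_bochner_integral_iff mult.assoc split: split_indicator)
    qed simp
  qed
  also have "\<dots> = (\<integral>\<^sup>+t. (\<integral>\<^sup>+y. ennreal (?k y t) \<partial>lborel) \<partial>lborel)"
    by (rule lborel_pair.Fubini'[symmetric]) measurable
  also have "\<dots> = (\<integral>\<^sup>+t. ennreal (Gamma (a + 1)) * ennreal (indicator {0..} t * (cosh (\<nu> * t) / cosh t powr (a + 1))) \<partial>lborel)"
  proof (intro nn_integral_cong)
    fix t :: real
    have "(\<integral>\<^sup>+y. ennreal (?k y t) \<partial>lborel) = (\<integral>\<^sup>+y. ennreal (indicator {0..} t * cosh (\<nu> * t)) *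
        ennreal (indicator {0<..} y * (y powr (a + 1 - 1) * exp (- y * cosh t))) \<partial>lborel)"
      by (intro nn_integral_cong) (simp add: ennreal_mult[symmetric] mult_ac)
    also have "\<dots> = ennreal (indicator {0..} t * cosh (\<nu> * t)) * ennreal (Gamma (a + 1) / cosh t powr (a + 1))"
      using a by (subst nn_integral_cmult, simp, subst nn_integral_Gamma_scaled) auto
    finally show "(\<integral>\<^sup>+y. ennreal (?k y t) \<partial>lborel) =
       ennreal (Gamma (a + 1)) * ennreal (indicator {0..} t * (cosh (\<nu> * t) / cosh t powr (a + 1)))"
      using a by (simp add: ennreal_mult[symmetric] Gamma_real_nonneg mult_ac)
  qed
  also have "\<dots> = ennreal (Gamma (a + 1)) * ennreal (2 powr (a + 1 - 2) * Beta ((a + 1 + \<nu>) / 2) ((a + 1 - \<nu>) / 2))"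
    using has_bochner_integral_cosh_over_cosh_powr[OF a]
    by (subst nn_integral_cmult, simp, subst nn_integral_eq_integral)
       (auto simp: has_bochner_integral_iff split: split_indicator)
  also have "\<dots> = ennreal (Gamma (a + 1) * (2 powr (a + 1 - 2) * Beta ((a + 1 + \<nu>) / 2) ((a + 1 - \<nu>) / 2)))"
    using a by (simp add: ennreal_mult'[symmetric] Gamma_real_nonneg)
  \<comment> \<open>The Beta arguments add up to \<open>a + 1\<close>, so
    \<open>Gamma (a + 1)\<close> cancels the denominator of \<open>Beta\<close>.\<close>
  also have "Gamma (a + 1) * (2 powr (a + 1 - 2) * Beta ((a + 1 + \<nu>) / 2) ((a + 1 - \<nu>) / 2)) =
      2 powr (a - 1) * Gamma ((a + \<nu> + 1) / 2) * Gamma ((a - \<nu> + 1) / 2)"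
  proof -
    have "Gamma (a + 1) > 0" using a by (intro Gamma_real_pos) auto
    moreover have "(a + 1 + \<nu>) / 2 + (a + 1 - \<nu>) / 2 = a + 1" by (simp add: field_simps)
    moreover have "(a + 1 + \<nu>) / 2 = (a + \<nu> + 1) / 2" "(a + 1 - \<nu>) / 2 = (a - \<nu> + 1) / 2" by simp_all
    ultimately show ?thesis unfolding Beta_def by (simp only:) simp
  qed
  finally show "(\<integral>\<^sup>+y. ennreal (indicator {0<..} y * (y powr a * bessel_K \<nu> y)) \<partial>lborel) =
      ennreal (2 powr (a - 1) * Gamma ((a + \<nu> + 1) / 2) * Gamma ((a - \<nu> + 1) / 2))" .
  show "0 \<le> 2 powr (a - 1) * Gamma ((a + \<nu> + 1) / 2) * Gamma ((a - \<nu> + 1) / 2)"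
    using a by (intro mult_nonneg_nonneg Gamma_real_nonneg) auto
  show "AE y in lborel. 0 \<le> indicator {0<..} y * (y powr a * bessel_K \<nu> y)"
    by (simp add: bessel_K_nonneg)
qed measurable

section \<open>The Struve-type series and the function G\<close>

text \<open>For positive parameters this is \<open>hypergeom_1F2 1 b c z\<close> divided by
  \<open>Gamma b * Gamma c\<close>. In this normalisation shifting a parameter needs no
  rescaling.\<close>

definition rGamma_series :: "real \<Rightarrow> real \<Rightarrow> real \<Rightarrow> real" where
  "rGamma_series b c z = (\<Sum>n. rGamma (b + real n) * rGamma (c + real n) * z ^ n)"

lemma rGamma_series_commute: "rGamma_series b c = rGamma_series c b"
  by (simp add: rGamma_series_def[abs_def] mult.commute)

text \<open>Consecutive terms have ratio \<open>z / ((b + n) * (c + n))\<close>, of modulus at most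
  1/2 once \<open>n \<ge> 2 * \<bar>z\<bar> + 1\<close>.\<close>

lemma summable_rGamma_series:
  fixes b c z :: real
  assumes "b > 0" "c > 0"
  shows "summable (\<lambda>n. rGamma (b + real n) * rGamma (c + real n) * z ^ n)"
proof (rule summable_ratio_test[of "1/2" "nat \<lceil>2 * \<bar>z\<bar> + 1\<rceil>"])
  fix n :: nat assume "n \<ge> nat \<lceil>2 * \<bar>z\<bar> + 1\<rceil>"
  then have n: "real n \<ge> 2 * \<bar>z\<bar> + 1" by linarith
  have "2 * \<bar>z\<bar> \<le> 1 * real n" using n by simp
  also have "1 * real n \<le> (b + real n) * (c + real n)"
    using n assms by (intro mult_mono) auto
  finally have z: "2 * \<bar>z\<bar> \<le> (b + real n) * (c + real n)" .
  let ?R = "\<lambda>n. \<bar>rGamma (b + real n)\<bar> * \<bar>rGamma (c + real n)\<bar> * \<bar>z\<bar> ^ n"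
  have rec: "\<bar>rGamma (x + real n)\<bar> = (x + real n) * \<bar>rGamma (x + real (Suc n))\<bar>" if "x > 0" for x
  proof -
    have "rGamma (x + real n) = (x + real n) * rGamma (x + real (Suc n))"
      using rGamma_plus1[of "x + real n"] by (simp add: add_ac)
    then show ?thesis using that by (simp add: abs_mult)
  qed
  have "2 * ?R (Suc n) = \<bar>rGamma (b + real (Suc n))\<bar> * \<bar>rGamma (c + real (Suc n))\<bar> * \<bar>z\<bar> ^ n * (2 * \<bar>z\<bar>)"
    by (simp add: mult_ac)
  also have "\<dots> \<le> \<bar>rGamma (b + real (Suc n))\<bar> * \<bar>rGamma (c + real (Suc n))\<bar> * \<bar>z\<bar> ^ n * ((b + real n) * (c + real n))"
    by (intro mult_left_mono z) auto
  also have "\<dots> = ?R n"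
    unfolding rec[OF assms(1)] rec[OF assms(2)] by (simp only: mult_ac)
  finally show "norm (rGamma (b + real (Suc n)) * rGamma (c + real (Suc n)) * z ^ Suc n)
      \<le> 1 / 2 * norm (rGamma (b + real n) * rGamma (c + real n) * z ^ n)"
    by (simp add: abs_mult power_abs)
qed simp

text \<open>The numerator parameter 1 gives \<open>pochhammer 1 n = fact n\<close>, which cancels;
  the other two Pochhammer symbols are Gamma quotients.\<close>

lemma hypergeom_1F2_eq_rGamma_series:
  assumes "b > 0" "c > 0"
  shows "hypergeom_1F2 1 b c z = Gamma b * Gamma c * rGamma_series b c z"
proof -
  have "pochhammer 1 n / (pochhammer b n * pochhammer c n) * z ^ n / fact n =
      Gamma b * Gamma c * (rGamma (b + real n) * rGamma (c + real n) * z ^ n)" for n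
  proof -
    have *: "pochhammer x n = Gamma (x + real n) / Gamma x" if "x > 0" for x
      using that by (auto intro!: pochhammer_Gamma elim!: nonpos_Ints_cases)
    show ?thesis
      unfolding *[OF assms(1)] *[OF assms(2)]
      by (simp add: pochhammer_fact[symmetric] rGamma_inverse_Gamma divide_simps)
  qed
  then show ?thesis
    unfolding hypergeom_1F2_def rGamma_series_def
    by (simp add: suminf_mult summable_rGamma_series[OF assms])
qed

text \<open>Split off the term \<open>n = 0\<close>; in \<open>G'\<close> this constant is all that
  survives.\<close>

lemma rGamma_series_shift:
  assumes "b > 0" "c > 0"
  shows "rGamma_series b c z = rGamma b * rGamma c + z * rGamma_series (b + 1) (c + 1) z"
proof -
  have "rGamma_series b c z = (\<Sum>n. rGamma (b + real (Suc n)) * rGamma (c + real (Suc n)) * z ^ Suc n) + rGamma b * rGamma c"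
    unfolding rGamma_series_def
    using suminf_split_head[OF summable_rGamma_series[OF assms, of z]] by simp
  also have "(\<lambda>n. rGamma (b + real (Suc n)) * rGamma (c + real (Suc n)) * z ^ Suc n) =
      (\<lambda>n. z * (rGamma (b + 1 + real n) * rGamma (c + 1 + real n) * z ^ n))"
    by (simp add: add_ac mult_ac)
  also have "suminf \<dots> = z * rGamma_series (b + 1) (c + 1) z"
    unfolding rGamma_series_def using assms by (intro suminf_mult summable_rGamma_series) auto
  finally show ?thesis by simp
qed

text \<open>Termwise, \<open>c + z * d/dz\<close> multiplies the coefficient of \<open>z ^ n\<close>
  by \<open>c + n\<close>, and \<open>(c + n) * rGamma (c + 1 + n) = rGamma (c + n)\<close>. The
  derivative matters only through this combination, hence the existential form.\<close>

lemma has_real_derivative_rGamma_series: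
  fixes b c :: real
  assumes "b > 0" "c > 0"
  shows "\<exists>D. (rGamma_series b (c + 1) has_real_derivative D) (at z) \<and>
             c * rGamma_series b (c + 1) z + z * D = rGamma_series b c z"
proof -
  define f where "f n = rGamma (b + real n) * rGamma (c + 1 + real n)" for n
  have sum: "summable (\<lambda>n. f n * z ^ n)" for z
    unfolding f_def using assms by (intro summable_rGamma_series) auto
  have sum': "summable (\<lambda>n. diffs f n * z ^ n)"
    using sum by (rule termdiff_converges_all)
  define D where "D = (\<Sum>n. diffs f n * z ^ n)"
  have S: "rGamma_series b (c + 1) = (\<lambda>z. \<Sum>n. f n * z ^ n)"
    by (simp add: rGamma_series_def[abs_def] f_def)
  have "(rGamma_series b (c + 1) has_real_derivative D) (at z)"
    unfolding S D_def by (rule termdiffs_strong_converges_everywhere) (rule sum)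
  moreover have "c * rGamma_series b (c + 1) z + z * D = rGamma_series b c z"
  proof -
    have "(\<lambda>n. of_nat n * f n * z ^ (n - Suc 0)) sums D"
      unfolding D_def by (rule diffs_equiv) (rule sum')
    then have "(\<lambda>n. z * (of_nat n * f n * z ^ (n - Suc 0))) sums (z * D)"
      by (rule sums_mult)
    moreover have "(\<lambda>n. c * (f n * z ^ n)) sums (c * rGamma_series b (c + 1) z)"
      unfolding S by (intro sums_mult summable_sums sum)
    ultimately have "(\<lambda>n. c * (f n * z ^ n) + z * (of_nat n * f n * z ^ (n - Suc 0))) sums (c * rGamma_series b (c + 1) z + z * D)"
      by (intro sums_add)
    moreover have "c * (f n * z ^ n) + z * (of_nat n * f n * z ^ (n - Suc 0)) = rGamma (b + real n) * rGamma (c + real n) * z ^ n" for n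
    proof -
      \<comment> \<open>At \<open>n = 0\<close>, where the exponent is truncated, the factor
        \<open>of_nat n\<close> makes both sides 0.\<close>
      have "z * (of_nat n * f n * z ^ (n - Suc 0)) = of_nat n * f n * z ^ n"
        by (cases n) auto
      moreover have "rGamma (c + real n) = (c + real n) * rGamma (c + 1 + real n)"
        using rGamma_plus1[of "c + real n"] by (simp add: add_ac)
      ultimately show ?thesis by (simp add: f_def algebra_simps)
    qed
    ultimately show ?thesis
      by (simp add: rGamma_series_def sums_iff)
  qed
  ultimately show ?thesis by blast
qed

lemma isCont_rGamma_series:
  assumes "b > 0" "c > 0"
  shows "isCont (rGamma_series b (c + 1)) z"
  using has_real_derivative_rGamma_series[OF assms] DERIV_isCont by blast

text \<open>The prefactor \<open>z powr c\<close> makes the product rule yield exactly the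
  combination in \<open>has_real_derivative_rGamma_series\<close>.\<close>

lemma has_real_derivative_powr_rGamma_series:
  fixes b c z :: real
  assumes "b > 0" "c > 0" "z > 0"
  shows "((\<lambda>z. z powr c * rGamma_series b (c + 1) z) has_real_derivative z powr (c - 1) * rGamma_series b c z) (at z)"
proof -
  from has_real_derivative_rGamma_series[OF assms(1,2)]
  obtain D where D: "(rGamma_series b (c + 1) has_real_derivative D) (at z)"
    "c * rGamma_series b (c + 1) z + z * D = rGamma_series b c z" by blast
  have "((\<lambda>z. z powr c * rGamma_series b (c + 1) z) has_real_derivative
      c * z powr (c - 1) * rGamma_series b (c + 1) z + D * z powr c) (at z)"
    by (intro DERIV_mult D has_real_derivative_powr assms)
  moreover have "z powr c = z * z powr (c - 1)" using assms by (simp add: powr_diff)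
  then have "c * z powr (c - 1) * rGamma_series b (c + 1) z + D * z powr c = z powr (c - 1) * rGamma_series b c z"
    by (simp add: D(2)[symmetric] algebra_simps)
  ultimately show ?thesis by simp
qed

section \<open>Boundary behaviour of powers times the Bessel function\<close>

text \<open>With \<open>b\<close> strictly between \<open>\<bar>\<nu>\<bar>\<close> and
  \<open>e\<close>, \<open>bessel_K_le_powr\<close> leaves a positive power of
  \<open>x\<close>.\<close>

lemma powr_bessel_K_tendsto_0_at_right:
  assumes "\<bar>\<nu>\<bar> < e"
  shows "((\<lambda>x. x powr e * bessel_K \<nu> x) \<longlongrightarrow> 0) (at_right 0)"
proof -
  obtain b where b: "\<bar>\<nu>\<bar> < b" "b < e" using dense assms by blast
  obtain C where C: "\<And>x. x > 0 \<Longrightarrow> bessel_K \<nu> x \<le> C * x powr (- b)"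
    using bessel_K_le_powr[OF b(1)] by blast
  have "norm (x powr e * bessel_K \<nu> x) \<le> C * x powr (e - b)" if "x > 0" for x
    using mult_left_mono[OF C[OF that], of "x powr e"] that
    by (simp add: bessel_K_nonneg abs_mult powr_diff powr_minus field_simps)
  then have "eventually (\<lambda>x. norm (x powr e * bessel_K \<nu> x) \<le> C * x powr (e - b)) (at_right 0)"
    by (auto intro: eventually_at_rightI[of 0 1])
  moreover have "((\<lambda>x. C * x powr (e - b)) \<longlongrightarrow> 0) (at_right 0)"
    using b by (intro tendsto_mult_right_zero tendsto_zero_powrI[where b = "e - b"])
      (auto intro: tendsto_ident_at eventually_at_rightI[of 0 1])
  ultimately show ?thesis by (rule Lim_null_comparison)
qed

text \<open>The same bound with \<open>b\<close> larger than both \<open>\<bar>\<nu>\<bar>\<close>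
  and \<open>e\<close> leaves a negative power.\<close>

lemma powr_bessel_K_tendsto_0_at_top: "((\<lambda>x. x powr e * bessel_K \<nu> x) \<longlongrightarrow> 0) at_top"
proof -
  define b where "b = \<bar>\<nu>\<bar> + \<bar>e\<bar> + 1"
  have b: "\<bar>\<nu>\<bar> < b" "e - b < 0" by (auto simp: b_def)
  obtain C where C: "\<And>x. x > 0 \<Longrightarrow> bessel_K \<nu> x \<le> C * x powr (- b)"
    using bessel_K_le_powr[OF b(1)] by blast
  have "norm (x powr e * bessel_K \<nu> x) \<le> C * x powr (e - b)" if "x > 0" for x
    using mult_left_mono[OF C[OF that], of "x powr e"] that
    by (simp add: bessel_K_nonneg abs_mult powr_diff powr_minus field_simps)
  then have "eventually (\<lambda>x. norm (x powr e * bessel_K \<nu> x) \<le> C * x powr (e - b)) at_top"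
    using eventually_gt_at_top[of 0] by (rule eventually_mono[rotated])
  moreover have "((\<lambda>x. C * x powr (e - b)) \<longlongrightarrow> 0) at_top"
    using b by (intro tendsto_mult_right_zero tendsto_neg_powr filterlim_ident) auto
  ultimately show ?thesis by (rule Lim_null_comparison)
qed

section \<open>The function G as an antiderivative\<close>

context
  fixes a \<nu> p q :: real
  assumes less: "\<bar>\<nu>\<bar> < a + 1"
  defines "p \<equiv> (a + \<nu> + 1) / 2" and "q \<equiv> (a - \<nu> + 1) / 2"
begin

lemma G_parameters_pos: "p > 0" "q > 0"
  using less by (auto simp: p_def q_def)

text \<open>The Gamma denominators of \<open>t_tilde\<close> cancel those of the series. Lowering
  \<open>a\<close> and \<open>\<nu>\<close> together keeps the parameter \<open>q + 1\<close> and
  turns \<open>p + 1\<close> into \<open>p\<close>.\<close>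

lemma t_tilde_eq_rGamma_series:
  assumes "x > 0"
  shows "t_tilde a \<nu> x = (x / 2) powr (a + 1) * rGamma_series (q + 1) (p + 1) (x\<^sup>2 / 4)"
    and "t_tilde (a - 1) (\<nu> - 1) x = (x / 2) powr a * rGamma_series p (q + 1) (x\<^sup>2 / 4)"
proof -
  have 1: "(a - \<nu> + 3) / 2 = q + 1" "(a + \<nu> + 3) / 2 = p + 1"
    "(a - 1 - (\<nu> - 1) + 3) / 2 = q + 1" "(a - 1 + (\<nu> - 1) + 3) / 2 = p"
    by (simp_all add: p_def q_def field_simps)
  have nz: "Gamma p \<noteq> 0" "Gamma (p + 1) \<noteq> 0" "Gamma (q + 1) \<noteq> 0"
    using G_parameters_pos Gamma_real_pos[of p] Gamma_real_pos[of "p + 1"] Gamma_real_pos[of "q + 1"]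
    by (metis add_pos_pos less_irrefl zero_less_one)+
  show "t_tilde a \<nu> x = (x / 2) powr (a + 1) * rGamma_series (q + 1) (p + 1) (x\<^sup>2 / 4)"
    "t_tilde (a - 1) (\<nu> - 1) x = (x / 2) powr a * rGamma_series p (q + 1) (x\<^sup>2 / 4)"
    unfolding t_tilde_def 1 using G_parameters_pos assms
    by (simp_all add: hypergeom_1F2_eq_rGamma_series powr_divide rGamma_series_commute[of p] nz)
qed

text \<open>Writing \<open>x = exp l\<close> and \<open>2 = exp c\<close> reduces each identity to a
  linear one between exponents. The first four serve \<open>G_fun_eq\<close> and the derivative of
  \<open>G_fun\<close>, the last two its limit at 0.\<close>

lemma G_prefactor_identities:
  assumes "x > 0"
  shows "x powr \<nu> * (2 powr (1 - \<nu>) * (x\<^sup>2 / 4) powr q) = x * (x / 2) powr a"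
    and "x powr (1 - \<nu>) * (2 powr \<nu> * (x\<^sup>2 / 4) powr p) = x * (x / 2) powr (a + 1)"
    and "x powr \<nu> * (2 powr (1 - \<nu>) * (x\<^sup>2 / 4) powr (q - 1)) * (x / 2) = x powr a * 2 powr (1 - a)"
    and "x powr (1 - \<nu>) * (2 powr \<nu> * (x\<^sup>2 / 4) powr (p - 1)) * (x / 2) = x * (x / 2) powr a"
    and "(x\<^sup>2 / 4) powr p = 4 powr (- p) * x powr (2 * p)"
    and "(x\<^sup>2 / 4) powr q = 4 powr (- q) * x powr (2 * q)"
proof -
  define l c :: real where "l = ln x" and "c = ln 2"
  have x: "x = exp l" and two: "2 = exp c" using assms by (simp_all add: l_def c_def)
  have four: "4 = exp (2 * c)" by (simp add: exp_double two[symmetric])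
  have z: "x\<^sup>2 / 4 = exp (2 * l - 2 * c)" by (simp add: x four exp_diff exp_double)
  have x2: "x / 2 = exp (l - c)" unfolding two by (simp add: x exp_diff)
  have e: "exp u powr v = exp (v * u)" for u v :: real by (simp add: powr_def)
  have pq: "p = (a + \<nu> + 1) * inverse 2" "q = (a - \<nu> + 1) * inverse 2" by (simp_all add: p_def q_def)
  \<comment> \<open>Only these particular powers of 2 and 4 are rewritten, so that numerals inside
    exponents stay as they are.\<close>
  have "exp c powr (1 - \<nu>) = (2::real) powr (1 - \<nu>)" "exp c powr \<nu> = (2::real) powr \<nu>" "exp c powr (1 - a) = (2::real) powr (1 - a)"
    "exp (2 * c) powr (- p) = (4::real) powr (- p)" "exp (2 * c) powr (- q) = (4::real) powr (- q)"
    by (simp_all only: two[symmetric] four[symmetric])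
  note r = this[symmetric]
  show "x powr \<nu> * (2 powr (1 - \<nu>) * (x\<^sup>2 / 4) powr q) = x * (x / 2) powr a"
    "x powr (1 - \<nu>) * (2 powr \<nu> * (x\<^sup>2 / 4) powr p) = x * (x / 2) powr (a + 1)"
    "x powr \<nu> * (2 powr (1 - \<nu>) * (x\<^sup>2 / 4) powr (q - 1)) * (x / 2) = x powr a * 2 powr (1 - a)"
    "x powr (1 - \<nu>) * (2 powr \<nu> * (x\<^sup>2 / 4) powr (p - 1)) * (x / 2) = x * (x / 2) powr a"
    "(x\<^sup>2 / 4) powr p = 4 powr (- p) * x powr (2 * p)"
    "(x\<^sup>2 / 4) powr q = 4 powr (- q) * x powr (2 * q)"
    unfolding r z x2 unfolding x e exp_add[symmetric] exp_inj_iff pq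
    by (simp_all add: field_simps)
qed

text \<open>In this form each of the four factors has a simple derivative: those of the Bessel factors lower the
  order, those of the series factors lower a parameter, and all mixed terms cancel in \<open>G'\<close>.\<close>
lemma G_fun_eq:
  assumes "x > 0"
  shows "G_fun a \<nu> x =
      (x powr \<nu> * bessel_K \<nu> x) * (2 powr (1 - \<nu>) * ((x\<^sup>2 / 4) powr q * rGamma_series p (q + 1) (x\<^sup>2 / 4)))
    + (x powr (1 - \<nu>) * bessel_K (1 - \<nu>) x) * (2 powr \<nu> * ((x\<^sup>2 / 4) powr p * rGamma_series (q + 1) (p + 1) (x\<^sup>2 / 4)))"
proof -
  have "bessel_K (\<nu> - 1) x = bessel_K (1 - \<nu>) x"
    using bessel_K_minus[of "1 - \<nu>" x] by simp
  then have "G_fun a \<nu> x = (x * (x / 2) powr a) * bessel_K \<nu> x * rGamma_series p (q + 1) (x\<^sup>2 / 4)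
     + (x * (x / 2) powr (a + 1)) * bessel_K (1 - \<nu>) x * rGamma_series (q + 1) (p + 1) (x\<^sup>2 / 4)"
    using assms by (simp add: G_fun_def t_tilde_eq_rGamma_series algebra_simps)
  then show ?thesis
    unfolding G_prefactor_identities(1,2)[OF assms, symmetric] by (simp only: mult_ac)
qed

text \<open>The product rule on \<open>G_fun_eq\<close> gives four terms. The two with
  \<open>bessel_K (1 - \<nu>) x\<close> have the same prefactor and cancel; the two with
  \<open>bessel_K \<nu> x\<close> differ by the shift of the series, which leaves its constant
  term.\<close>

lemma has_real_derivative_G_fun:
  assumes x: "x > 0"
  shows "(G_fun a \<nu> has_real_derivative 2 powr (1 - a) * rGamma p * rGamma q * (x powr a * bessel_K \<nu> x)) (at x)"
proof -
  let ?z = "x\<^sup>2 / 4"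
  let ?V = "\<lambda>x. 2 powr (1 - \<nu>) * ((x\<^sup>2 / 4) powr q * rGamma_series p (q + 1) (x\<^sup>2 / 4))"
  let ?Y = "\<lambda>x. 2 powr \<nu> * ((x\<^sup>2 / 4) powr p * rGamma_series (q + 1) (p + 1) (x\<^sup>2 / 4))"
  have z: "?z > 0" using x by simp
  have dz: "((\<lambda>x. x\<^sup>2 / 4) has_real_derivative x / 2) (at x)"
    by (auto intro!: derivative_eq_intros)
  have q1: "q + 1 > 0" using G_parameters_pos by simp
  have V: "(?V has_real_derivative 2 powr (1 - \<nu>) * (?z powr (q - 1) * rGamma_series p q ?z * (x / 2))) (at x)"
    using DERIV_chain[OF has_real_derivative_powr_rGamma_series[OF G_parameters_pos z] dz]
    by (intro DERIV_cmult) (simp add: o_def)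
  have Y: "(?Y has_real_derivative 2 powr \<nu> * (?z powr (p - 1) * rGamma_series (q + 1) p ?z * (x / 2))) (at x)"
    using DERIV_chain[OF has_real_derivative_powr_rGamma_series[OF q1 G_parameters_pos(1) z] dz]
    by (intro DERIV_cmult) (simp add: o_def)
  \<comment> \<open>Evenness in the order: differentiating either Bessel factor reproduces the
    other, so only two orders occur.\<close>
  have K: "bessel_K (\<nu> - 1) x = bessel_K (1 - \<nu>) x" "bessel_K (1 - \<nu> - 1) x = bessel_K \<nu> x"
    using bessel_K_minus[of "1 - \<nu>" x] bessel_K_minus[of \<nu> x] by simp_all
  let ?D = "- (x powr \<nu> * bessel_K (\<nu> - 1) x) * ?V x
      + 2 powr (1 - \<nu>) * (?z powr (q - 1) * rGamma_series p q ?z * (x / 2)) * (x powr \<nu> * bessel_K \<nu> x)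
    + (- (x powr (1 - \<nu>) * bessel_K (1 - \<nu> - 1) x) * ?Y x
      + 2 powr \<nu> * (?z powr (p - 1) * rGamma_series (q + 1) p ?z * (x / 2)) * (x powr (1 - \<nu>) * bessel_K (1 - \<nu>) x))"
  have D: "((\<lambda>x. (x powr \<nu> * bessel_K \<nu> x) * ?V x + (x powr (1 - \<nu>) * bessel_K (1 - \<nu>) x) * ?Y x)
      has_real_derivative ?D) (at x)"
    by (intro DERIV_add DERIV_mult V Y has_real_derivative_powr_bessel_K x)
  have "?D = - (x powr \<nu> * (2 powr (1 - \<nu>) * ?z powr q)) * bessel_K (1 - \<nu>) x * rGamma_series p (q + 1) ?z
      + (x powr \<nu> * (2 powr (1 - \<nu>) * ?z powr (q - 1)) * (x / 2)) * bessel_K \<nu> x * rGamma_series p q ?z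
      - (x powr (1 - \<nu>) * (2 powr \<nu> * ?z powr p)) * bessel_K \<nu> x * rGamma_series (q + 1) (p + 1) ?z
      + (x powr (1 - \<nu>) * (2 powr \<nu> * ?z powr (p - 1)) * (x / 2)) * bessel_K (1 - \<nu>) x * rGamma_series p (q + 1) ?z"
    unfolding K rGamma_series_commute[of "q + 1" p] by (simp add: algebra_simps)
  also have "\<dots> = x powr a * 2 powr (1 - a) * bessel_K \<nu> x * rGamma_series p q ?z
      - x * (x / 2) powr (a + 1) * bessel_K \<nu> x * rGamma_series (q + 1) (p + 1) ?z"
    unfolding G_prefactor_identities(1-4)[OF x] by (simp add: algebra_simps)
  also have "\<dots> = 2 powr (1 - a) * rGamma p * rGamma q * (x powr a * bessel_K \<nu> x)"
  proof -
    have 1: "x * (x / 2) powr (a + 1) = x powr a * 2 powr (1 - a) * ?z"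
      using x by (simp add: powr_divide powr_add powr_diff power2_eq_square field_simps)
    have 2: "rGamma_series p q ?z = rGamma p * rGamma q + ?z * rGamma_series (q + 1) (p + 1) ?z"
      using rGamma_series_shift[OF G_parameters_pos] by (simp add: rGamma_series_commute[of "q + 1"])
    show ?thesis unfolding 1 2 by (simp only: distrib_left mult_ac add_diff_cancel_right')
  qed
  finally have "?D = 2 powr (1 - a) * rGamma p * rGamma q * (x powr a * bessel_K \<nu> x)" .
  with D have "((\<lambda>x. (x powr \<nu> * bessel_K \<nu> x) * ?V x + (x powr (1 - \<nu>) * bessel_K (1 - \<nu>) x) * ?Y x)
      has_real_derivative 2 powr (1 - a) * rGamma p * rGamma q * (x powr a * bessel_K \<nu> x)) (at x)"
    by simp
  then show ?thesis
    by (rule has_field_derivative_transform_within_open[of _ _ _ "{0<..}"]) (auto simp: x G_fun_eq)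
qed

text \<open>All prefactors collapse to \<open>x powr (a + 1) * bessel_K \<nu> x\<close> and
  \<open>x powr (a + 2) * bessel_K (1 - \<nu>) x\<close>. Both vanish at 0 since
  \<open>\<bar>\<nu>\<bar> < a + 1\<close> and hence \<open>\<bar>1 - \<nu>\<bar> < a + 2\<close>,
  while the series factors stay continuous.\<close>

lemma G_fun_tendsto_0: "(G_fun a \<nu> \<longlongrightarrow> 0) (at_right 0)"
proof -
  have lim: "((\<lambda>x. x\<^sup>2 / 4) \<longlongrightarrow> (0::real)) (at_right 0)"
    by (auto intro!: tendsto_eq_intros)
  have V: "((\<lambda>x. rGamma_series p (q + 1) (x\<^sup>2 / 4)) \<longlongrightarrow> rGamma_series p (q + 1) 0) (at_right 0)"
    by (rule isCont_tendsto_compose[OF isCont_rGamma_series lim]) (use G_parameters_pos in auto)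
  have Y: "((\<lambda>x. rGamma_series (q + 1) (p + 1) (x\<^sup>2 / 4)) \<longlongrightarrow> rGamma_series (q + 1) (p + 1) 0) (at_right 0)"
    by (rule isCont_tendsto_compose[OF isCont_rGamma_series lim]) (use G_parameters_pos in auto)
  have "((\<lambda>x. (x powr (a + 1) * bessel_K \<nu> x) * (2 powr (1 - \<nu>) * 4 powr (- q) * rGamma_series p (q + 1) (x\<^sup>2 / 4))
      + (x powr (a + 2) * bessel_K (1 - \<nu>) x) * (2 powr \<nu> * 4 powr (- p) * rGamma_series (q + 1) (p + 1) (x\<^sup>2 / 4)))
     \<longlongrightarrow> 0 * (2 powr (1 - \<nu>) * 4 powr (- q) * rGamma_series p (q + 1) 0)
         + 0 * (2 powr \<nu> * 4 powr (- p) * rGamma_series (q + 1) (p + 1) 0)) (at_right 0)"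
    using less by (intro tendsto_add tendsto_mult V Y powr_bessel_K_tendsto_0_at_right tendsto_const) auto
  then have "((\<lambda>x. (x powr (a + 1) * bessel_K \<nu> x) * (2 powr (1 - \<nu>) * 4 powr (- q) * rGamma_series p (q + 1) (x\<^sup>2 / 4))
      + (x powr (a + 2) * bessel_K (1 - \<nu>) x) * (2 powr \<nu> * 4 powr (- p) * rGamma_series (q + 1) (p + 1) (x\<^sup>2 / 4))) \<longlongrightarrow> 0) (at_right 0)"
    by simp
  then show ?thesis
  proof (rule Lim_transform_eventually, intro eventually_at_rightI[of 0 1])
    fix x :: real assume "x \<in> {0<..<1}"
    then have x: "x > 0" by simp
    have "x powr (a + 1) = x powr \<nu> * x powr (2 * q)" "x powr (a + 2) = x powr (1 - \<nu>) * x powr (2 * p)"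
      unfolding powr_add[symmetric] by (rule arg_cong[of _ _ "(powr) x"], simp add: p_def q_def field_simps)+
    then show "(x powr (a + 1) * bessel_K \<nu> x) * (2 powr (1 - \<nu>) * 4 powr (- q) * rGamma_series p (q + 1) (x\<^sup>2 / 4))
      + (x powr (a + 2) * bessel_K (1 - \<nu>) x) * (2 powr \<nu> * 4 powr (- p) * rGamma_series (q + 1) (p + 1) (x\<^sup>2 / 4)) = G_fun a \<nu> x"
      unfolding G_fun_eq[OF x] G_prefactor_identities(5,6)[OF x] by (simp only: mult_ac)
  qed simp
qed

text \<open>The constant \<open>c\<close> inverts the one in
  \<open>has_real_derivative_G_fun\<close>, so \<open>c * G_fun a \<nu>\<close> is an antiderivative
  on \<open>(0, m)\<close>; the fundamental theorem then needs only continuity at the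
  endpoints.\<close>

lemma has_bochner_integral_powr_bessel_K_truncated:
  assumes m: "m \<ge> 0"
  shows "has_bochner_integral lborel (\<lambda>y. indicator {0<..<m} y * (y powr a * bessel_K \<nu> y))
     (2 powr (a - 1) * Gamma p * Gamma q * G_fun a \<nu> m)"
proof -
  define c where "c = 2 powr (a - 1) * Gamma p * Gamma q"
  have c: "c * (2 powr (1 - a) * rGamma p * rGamma q) = 1"
  proof -
    have "Gamma p > 0" "Gamma q > 0" using G_parameters_pos by auto
    moreover have "2 powr (a - 1) * 2 powr (1 - a) = (1::real)" by (simp flip: powr_add)
    ultimately show ?thesis by (simp add: c_def rGamma_inverse_Gamma field_simps)
  qed
  have deriv: "((\<lambda>x. c * G_fun a \<nu> x) has_real_derivative x powr a * bessel_K \<nu> x) (at x)" if "x > 0" for x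
    using DERIV_cmult[OF has_real_derivative_G_fun[OF that], of c]
    by (simp add: mult.assoc[symmetric] c[unfolded mult.assoc[symmetric]])
  \<comment> \<open>At 0 the convention \<open>G_fun a \<nu> 0 = 0\<close> matches the limit from
    the right.\<close>
  have "continuous (at x within {0..m}) (\<lambda>x. c * G_fun a \<nu> x)" if "x \<in> {0..m}" for x
  proof (cases "x = 0")
    case True
    have "((\<lambda>x. c * G_fun a \<nu> x) \<longlongrightarrow> c * G_fun a \<nu> 0) (at_right 0)"
      using tendsto_mult_left[OF G_fun_tendsto_0, of c] by (simp add: G_fun_def)
    then show ?thesis
      unfolding True continuous_within at_within_Ici_at_right[symmetric]
      by (rule tendsto_within_subset) auto
  next
    case False
    with that have "x > 0" by simp
    from DERIV_isCont[OF deriv[OF this]] show ?thesis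
      by (rule continuous_at_imp_continuous_at_within)
  qed
  then have "continuous_on {0..m} (\<lambda>x. c * G_fun a \<nu> x)"
    by (simp add: continuous_on_eq_continuous_within)
  then have "((\<lambda>y. y powr a * bessel_K \<nu> y) has_integral c * G_fun a \<nu> m - c * G_fun a \<nu> 0) {0..m}"
    using deriv m
    by (intro fundamental_theorem_of_calculus_interior)
       (auto simp flip: has_real_derivative_iff_has_vector_derivative)
  then have "((\<lambda>y. y powr a * bessel_K \<nu> y) has_integral c * G_fun a \<nu> m) {0<..<m}"
    by (simp add: has_integral_Icc_iff_Ioo G_fun_def)
  then show ?thesis
    unfolding c_def
    by (rule has_bochner_integral_of_has_integral_nonneg) (simp_all add: bessel_K_nonneg)
qed

end

text \<open>The antiderivative \<open>- (x powr (\<nu> + 1) * bessel_K (\<nu> + 1) x)\<close>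
  vanishes at infinity.\<close>

lemma has_bochner_integral_powr_bessel_K_tail:
  fixes m \<nu> :: real
  assumes "m > 0"
  shows "has_bochner_integral lborel (\<lambda>y. indicator {m..} y * (y powr (\<nu> + 1) * bessel_K \<nu> y))
     (m powr (\<nu> + 1) * bessel_K (\<nu> + 1) m)"
proof (rule has_bochner_integral_nn_integral)
  have "(\<integral>\<^sup>+y. ennreal (y powr (\<nu> + 1) * bessel_K \<nu> y) * indicator {m..} y \<partial>lborel) =
      ennreal (0 - - (m powr (\<nu> + 1) * bessel_K (\<nu> + 1) m))"
  proof (rule nn_integral_FTC_atLeast)
    show "((\<lambda>x. - (x powr (\<nu> + 1) * bessel_K (\<nu> + 1) x)) has_real_derivative x powr (\<nu> + 1) * bessel_K \<nu> x) (at x)"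
      if "m \<le> x" for x
      using DERIV_minus[OF has_real_derivative_powr_bessel_K[of x "\<nu> + 1"]] that assms by simp
    show "((\<lambda>x. - (x powr (\<nu> + 1) * bessel_K (\<nu> + 1) x)) \<longlongrightarrow> 0) at_top"
      using tendsto_minus[OF powr_bessel_K_tendsto_0_at_top] by simp
  qed (simp_all add: bessel_K_nonneg)
  then show "(\<integral>\<^sup>+y. ennreal (indicator {m..} y * (y powr (\<nu> + 1) * bessel_K \<nu> y)) \<partial>lborel) =
      ennreal (m powr (\<nu> + 1) * bessel_K (\<nu> + 1) m)"
    by (simp add: mult.commute[of "indicator _ _"] ennreal_mult'' ennreal_indicator)
qed (simp_all add: bessel_K_nonneg)

section \<open>Absolute moments of the variance-gamma density\<close>

text \<open>The sum \<open>g y + g (- y)\<close> is even, so its full integral is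
  \<open>2 * I\<close>. Nonnegativity makes \<open>g\<close> integrable by comparison with this sum,
  and reflection shows that both summands contribute equally.\<close>

lemma has_bochner_integral_fold_even:
  fixes g :: "real \<Rightarrow> real"
  assumes I: "has_bochner_integral lborel (\<lambda>y. indicator {0<..} y * (g y + g (- y))) I"
    and nonneg: "\<And>y. 0 \<le> g y" and [measurable]: "g \<in> borel_measurable borel"
  shows "has_bochner_integral lborel g I"
proof -
  have "has_bochner_integral lborel (\<lambda>y. indicator {0..} y *\<^sub>R (g y + g (- y))) I"
    using I by (rule has_bochner_integral_discrete_difference[where X="{0}", THEN iffD1, rotated 4])
      (auto split: split_indicator)
  then have e: "has_bochner_integral lborel (\<lambda>y. g y + g (- y)) (2 *\<^sub>R I)"
    by (rule has_bochner_integral_even_function) simp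
  have g: "integrable lborel g"
    by (rule Bochner_Integration.integrable_bound[OF integrable.intros[OF e]]) (use nonneg in \<open>auto intro!: AE_I2\<close>)
  have "has_bochner_integral lborel (\<lambda>y. g (- y)) (integral\<^sup>L lborel g)"
    using has_bochner_integral_integrable[OF g]
      lborel_has_bochner_integral_real_affine_iff[of "-1" g "integral\<^sup>L lborel g" 0] by simp
  from has_bochner_integral_add[OF has_bochner_integral_integrable[OF g] this] e
  have "integral\<^sup>L lborel g + integral\<^sup>L lborel g = 2 * I"
    by (auto dest: has_bochner_integral_eq)
  with has_bochner_integral_integrable[OF g] show ?thesis by simp
qed

text \<open>For odd \<open>r\<close>, \<open>\<bar>y - m\<bar> ^ r\<close> is
  \<open>(y - m) ^ r\<close> up to a sign that changes at \<open>y = m\<close>; the second sum is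
  the correction below \<open>m\<close>, expanded by the binomial theorem.\<close>

lemma abs_power_plus_abs_power_odd:
  fixes y m :: real and r :: nat
  assumes r: "odd r" and y: "y > 0" and m: "m \<ge> 0"
  shows "\<bar>y + m\<bar> ^ r + \<bar>y - m\<bar> ^ r =
      (\<Sum>k = 0..(r - 1) div 2. 2 * real (r choose (2 * k)) * m ^ (2 * k) * y ^ (r - 2 * k))
      - (\<Sum>k = 0..r. 2 * real (r choose k) * (- m) ^ k * (indicator {0<..<m} y * y ^ (r - k)))"
proof -
  have bin: "(y + x) ^ r = (\<Sum>k\<le>r. real (r choose k) * x ^ k * y ^ (r - k))" for x
    using binomial_ring[of x y r] by (simp add: add.commute)
  have "\<bar>y + m\<bar> ^ r + \<bar>y - m\<bar> ^ r = (y + m) ^ r + (y - m) ^ r - 2 * (indicator {0<..<m} y * (y - m) ^ r)"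
  proof (cases "y < m")
    case True
    then have "\<bar>y - m\<bar> ^ r = - ((y - m) ^ r)"
      using r by (simp add: abs_if flip: power_minus_odd)
    then show ?thesis using True y m by simp
  next
    case False
    then show ?thesis using y m by simp
  qed
  also have "(y + m) ^ r + (y - m) ^ r = (\<Sum>k = 0..(r - 1) div 2. 2 * real (r choose (2 * k)) * m ^ (2 * k) * y ^ (r - 2 * k))"
  proof -
    obtain n where n: "r = Suc (2 * n)" using r by (auto elim: oddE)
    have "(y + m) ^ r + (y - m) ^ r = (\<Sum>k\<le>r. real (r choose k) * (m ^ k + (- m) ^ k) * y ^ (r - k))"
      using bin[of m] bin[of "- m"] by (simp add: sum.distrib algebra_simps)
    \<comment> \<open>The coefficient \<open>m ^ k + (- m) ^ k\<close> vanishes for odd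
      \<open>k\<close>. As \<open>r = 2 * n + 1\<close>, pairing each even index with its successor
      exhausts the sum.\<close>
    also have "\<dots> = (\<Sum>k\<le>n. 2 * real (r choose (2 * k)) * m ^ (2 * k) * y ^ (r - 2 * k))"
      unfolding n sum.in_pairs_0 by (intro sum.cong) auto
    finally show ?thesis by (simp add: n atMost_atLeast0)
  qed
  also have "2 * (indicator {0<..<m} y * (y - m) ^ r) =
      (\<Sum>k = 0..r. 2 * real (r choose k) * (- m) ^ k * (indicator {0<..<m} y * y ^ (r - k)))"
    using bin[of "- m"] by (simp add: sum_distrib_left mult_ac atMost_atLeast0)
  finally show ?thesis .
qed

section \<open>The rescaled kernel and its moments\<close>

text \<open>Up to normalisation, the density of \<open>\<alpha> * (X - \<mu>)\<close>.\<close>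

definition vg_kernel :: "real \<Rightarrow> real \<Rightarrow> real" where
  "vg_kernel \<nu> y = \<bar>y\<bar> powr \<nu> * bessel_K \<nu> \<bar>y\<bar>"

text \<open>The Gamma factors of the moment of order \<open>s\<close> of
  \<open>vg_kernel \<nu>\<close> over the positive half-line.\<close>

definition Gamma_pair :: "real \<Rightarrow> real \<Rightarrow> real" where
  "Gamma_pair \<nu> s = Gamma ((s + 1) / 2) * Gamma (\<nu> + (s + 1) / 2)"

lemma vg_kernel_nonneg: "vg_kernel \<nu> y \<ge> 0"
  by (simp add: vg_kernel_def bessel_K_nonneg)

lemma vg_kernel_minus [simp]: "vg_kernel \<nu> (- y) = vg_kernel \<nu> y"
  by (simp add: vg_kernel_def)

lemma vg_kernel_measurable [measurable]: "vg_kernel \<nu> \<in> borel_measurable borel"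
  unfolding vg_kernel_def[abs_def] by measurable

text \<open>Of the power \<open>\<alpha> powr (2 * \<nu> + 1)\<close>, one
  \<open>\<alpha> powr \<nu>\<close> cancels against \<open>(2 * \<alpha>) powr \<nu>\<close>,
  another joins \<open>\<bar>x - \<mu>\<bar> powr \<nu>\<close>, and \<open>\<alpha>\<close>
  remains.\<close>

lemma VG_density_eq_vg_kernel:
  assumes "\<alpha> > 0"
  shows "VG_density \<nu> \<alpha> 0 \<mu> x = \<alpha> / (sqrt pi * 2 powr \<nu> * Gamma (\<nu> + 1 / 2)) * vg_kernel \<nu> (\<alpha> * (x - \<mu>))"
proof -
  have "(\<alpha>\<^sup>2) powr (\<nu> + 1 / 2) = \<alpha> powr (2 * (\<nu> + 1 / 2))"
    using assms by (simp add: powr_powr flip: powr_numeral)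
  also have "\<dots> = \<alpha> * \<alpha> powr \<nu> * \<alpha> powr \<nu>"
    using assms by (simp add: powr_add distrib_left) (simp flip: powr_add)
  finally show ?thesis
    using assms by (simp add: VG_density_def vg_kernel_def abs_mult powr_mult)
qed

lemma VG_density_nonneg:
  assumes "\<nu> > - 1 / 2" "\<alpha> > 0"
  shows "VG_density \<nu> \<alpha> 0 \<mu> x \<ge> 0"
  using assms by (simp add: VG_density_eq_vg_kernel vg_kernel_nonneg Gamma_real_nonneg)

text \<open>At equal indices the first series parameter is 3/2; this is how Struve functions enter
  the case \<open>r = 1\<close>.\<close>

lemma t_tilde_diagonal: "x \<ge> 0 \<Longrightarrow> t_tilde \<nu> \<nu> x = struve_L \<nu> x"
  by (simp add: t_tilde_def struve_L_def powr_divide add_divide_distrib mult_ac)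

context
  fixes \<nu> :: real
  assumes \<nu>: "\<nu> > - 1 / 2"
begin

lemma has_bochner_integral_vg_kernel_power:
  "has_bochner_integral lborel (\<lambda>y. indicator {0<..} y * (y ^ s * vg_kernel \<nu> y))
     (2 powr (\<nu> + real s - 1) * Gamma_pair \<nu> (real s))"
proof -
  \<comment> \<open>For negative \<open>\<nu>\<close> and \<open>s = 0\<close> this is exactly the
    condition \<open>\<nu> > - 1 / 2\<close>.\<close>
  have "\<bar>\<nu>\<bar> < \<nu> + real s + 1" using \<nu> by linarith
  from has_bochner_integral_powr_bessel_K[OF this]
  have "has_bochner_integral lborel (\<lambda>y. indicator {0<..} y * (y powr (\<nu> + real s) * bessel_K \<nu> y))
     (2 powr (\<nu> + real s - 1) * Gamma_pair \<nu> (real s))"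
    by (simp add: Gamma_pair_def add_divide_distrib algebra_simps)
  then show ?thesis
    by (rule has_bochner_integral_cong[THEN iffD1, rotated 3])
       (simp_all add: vg_kernel_def powr_add powr_realpow split: split_indicator)
qed

lemma has_bochner_integral_vg_kernel_power_truncated:
  assumes "m \<ge> 0"
  shows "has_bochner_integral lborel (\<lambda>y. indicator {0<..<m} y * (y ^ s * vg_kernel \<nu> y))
     (2 powr (\<nu> + real s - 1) * Gamma_pair \<nu> (real s) * G_fun (\<nu> + real s) \<nu> m)"
proof -
  have "\<bar>\<nu>\<bar> < \<nu> + real s + 1" using \<nu> by linarith
  from has_bochner_integral_powr_bessel_K_truncated[OF this assms]
  have "has_bochner_integral lborel (\<lambda>y. indicator {0<..<m} y * (y powr (\<nu> + real s) * bessel_K \<nu> y))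
     (2 powr (\<nu> + real s - 1) * Gamma_pair \<nu> (real s) * G_fun (\<nu> + real s) \<nu> m)"
    by (simp add: Gamma_pair_def add_divide_distrib algebra_simps)
  then show ?thesis
    by (rule has_bochner_integral_cong[THEN iffD1, rotated 3])
       (simp_all add: vg_kernel_def powr_add powr_realpow split: split_indicator)
qed

text \<open>Folding at 0 adds the integrands at \<open>y\<close> and \<open>- y\<close>. The kernel
  is even, so this sum depends on \<open>w\<close> only through
  \<open>\<bar>w\<bar>\<close>.\<close>

lemma has_bochner_integral_vg_kernel_shift:
  fixes w I :: real and r :: nat
  assumes "has_bochner_integral lborel (\<lambda>y. indicator {0<..} y * ((\<bar>y + \<bar>w\<bar>\<bar> ^ r + \<bar>y - \<bar>w\<bar>\<bar> ^ r) * vg_kernel \<nu> y)) I"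
  shows "has_bochner_integral lborel (\<lambda>y. \<bar>y + w\<bar> ^ r * vg_kernel \<nu> y) I"
proof (rule has_bochner_integral_fold_even)
  have "\<bar>y + \<bar>w\<bar>\<bar> ^ r + \<bar>y - \<bar>w\<bar>\<bar> ^ r = \<bar>y + w\<bar> ^ r + \<bar>- y + w\<bar> ^ r" for y
    using abs_minus_commute[of y w] by (cases "w \<ge> 0") (simp_all add: abs_minus_commute add.commute)
  with assms show "has_bochner_integral lborel (\<lambda>y. indicator {0<..} y *
      (\<bar>y + w\<bar> ^ r * vg_kernel \<nu> y + \<bar>- y + w\<bar> ^ r * vg_kernel \<nu> (- y))) I"
    by (simp add: distrib_right)
qed (simp_all add: vg_kernel_nonneg)

lemma has_bochner_integral_vg_kernel_abs_odd:
  fixes w :: real and r :: nat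
  assumes r: "odd r"
  defines "m \<equiv> \<bar>w\<bar>"
  shows "has_bochner_integral lborel (\<lambda>y. \<bar>y + w\<bar> ^ r * vg_kernel \<nu> y)
     (2 powr \<nu> * 2 ^ r *
       ((\<Sum>k = 0..(r - 1) div 2. real (r choose (2 * k)) * (m / 2) ^ (2 * k) * Gamma_pair \<nu> (real (r - 2 * k)))
      - (\<Sum>k = 0..r. real (r choose k) * (- 1) ^ k * (m / 2) ^ k * Gamma_pair \<nu> (real (r - k)) * G_fun (\<nu> + real (r - k)) \<nu> m)))"
proof (rule has_bochner_integral_vg_kernel_shift)
  have m: "m \<ge> 0" by (simp add: m_def)
  \<comment> \<open>The moment carries \<open>2 powr (\<nu> + (r - k) - 1)\<close>; with the leading
    2 this gives the common factor \<open>2 powr \<nu> * 2 ^ r\<close> and turns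
    \<open>x ^ k\<close> into \<open>(x / 2) ^ k\<close>.\<close>
  have scale: "2 * C * x ^ k * (2 powr (\<nu> + real (r - k) - 1) * D) = 2 powr \<nu> * 2 ^ r * (C * (x / 2) ^ k * D)"
    if "k \<le> r" for k C x D
    using that by (simp add: powr_add powr_diff powr_realpow power_diff power_divide)
  have "has_bochner_integral lborel
     (\<lambda>y. (\<Sum>k = 0..(r - 1) div 2. 2 * real (r choose (2 * k)) * m ^ (2 * k) *
             (indicator {0<..} y * (y ^ (r - 2 * k) * vg_kernel \<nu> y)))
        - (\<Sum>k = 0..r. 2 * real (r choose k) * (- m) ^ k * (indicator {0<..<m} y * (y ^ (r - k) * vg_kernel \<nu> y))))
     ((\<Sum>k = 0..(r - 1) div 2. 2 * real (r choose (2 * k)) * m ^ (2 * k) *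
             (2 powr (\<nu> + real (r - 2 * k) - 1) * Gamma_pair \<nu> (real (r - 2 * k))))
        - (\<Sum>k = 0..r. 2 * real (r choose k) * (- m) ^ k *
             (2 powr (\<nu> + real (r - k) - 1) * Gamma_pair \<nu> (real (r - k)) * G_fun (\<nu> + real (r - k)) \<nu> m)))"
    by (intro has_bochner_integral_diff has_bochner_integral_sum has_bochner_integral_mult_right
        has_bochner_integral_vg_kernel_power has_bochner_integral_vg_kernel_power_truncated m)
  moreover have "(\<Sum>k = 0..(r - 1) div 2. 2 * real (r choose (2 * k)) * m ^ (2 * k) *
             (indicator {0<..} y * (y ^ (r - 2 * k) * vg_kernel \<nu> y)))
        - (\<Sum>k = 0..r. 2 * real (r choose k) * (- m) ^ k * (indicator {0<..<m} y * (y ^ (r - k) * vg_kernel \<nu> y)))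
      = indicator {0<..} y * ((\<bar>y + m\<bar> ^ r + \<bar>y - m\<bar> ^ r) * vg_kernel \<nu> y)" for y
  proof (cases "y > 0")
    case True
    show ?thesis
      unfolding abs_power_plus_abs_power_odd[OF r True m]
      using True by (simp add: right_diff_distrib sum_distrib_left mult_ac)
  qed simp
  moreover have "(\<Sum>k = 0..(r - 1) div 2. 2 * real (r choose (2 * k)) * m ^ (2 * k) *
             (2 powr (\<nu> + real (r - 2 * k) - 1) * Gamma_pair \<nu> (real (r - 2 * k))))
      = 2 powr \<nu> * 2 ^ r * (\<Sum>k = 0..(r - 1) div 2. real (r choose (2 * k)) * (m / 2) ^ (2 * k) * Gamma_pair \<nu> (real (r - 2 * k)))"
    unfolding sum_distrib_left
  proof (rule sum.cong)
    fix k assume "k \<in> {0..(r - 1) div 2}"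
    then have "2 * k \<le> r" by auto
    then show "2 * real (r choose (2 * k)) * m ^ (2 * k) * (2 powr (\<nu> + real (r - 2 * k) - 1) * Gamma_pair \<nu> (real (r - 2 * k)))
      = 2 powr \<nu> * 2 ^ r * (real (r choose (2 * k)) * (m / 2) ^ (2 * k) * Gamma_pair \<nu> (real (r - 2 * k)))"
      by (rule scale)
  qed simp
  moreover have "(\<Sum>k = 0..r. 2 * real (r choose k) * (- m) ^ k *
             (2 powr (\<nu> + real (r - k) - 1) * Gamma_pair \<nu> (real (r - k)) * G_fun (\<nu> + real (r - k)) \<nu> m))
      = 2 powr \<nu> * 2 ^ r * (\<Sum>k = 0..r. real (r choose k) * (- 1) ^ k * (m / 2) ^ k * Gamma_pair \<nu> (real (r - k)) * G_fun (\<nu> + real (r - k)) \<nu> m)"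
    unfolding sum_distrib_left
  proof (rule sum.cong)
    fix k assume "k \<in> {0..r}"
    then show "2 * real (r choose k) * (- m) ^ k *
             (2 powr (\<nu> + real (r - k) - 1) * Gamma_pair \<nu> (real (r - k)) * G_fun (\<nu> + real (r - k)) \<nu> m)
      = 2 powr \<nu> * 2 ^ r * (real (r choose k) * (- 1) ^ k * (m / 2) ^ k * Gamma_pair \<nu> (real (r - k)) * G_fun (\<nu> + real (r - k)) \<nu> m)"
      using scale[of k "real (r choose k)" "- m" "Gamma_pair \<nu> (real (r - k)) * G_fun (\<nu> + real (r - k)) \<nu> m"]
      by (simp add: power_minus[of "m / 2"] mult.assoc)
  qed simp
  ultimately show "has_bochner_integral lborel
      (\<lambda>y. indicator {0<..} y * ((\<bar>y + \<bar>w\<bar>\<bar> ^ r + \<bar>y - \<bar>w\<bar>\<bar> ^ r) * vg_kernel \<nu> y))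
      (2 powr \<nu> * 2 ^ r *
       ((\<Sum>k = 0..(r - 1) div 2. real (r choose (2 * k)) * (m / 2) ^ (2 * k) * Gamma_pair \<nu> (real (r - 2 * k)))
      - (\<Sum>k = 0..r. real (r choose k) * (- 1) ^ k * (m / 2) ^ k * Gamma_pair \<nu> (real (r - k)) * G_fun (\<nu> + real (r - k)) \<nu> m)))"
    unfolding m_def[symmetric] by (simp only: right_diff_distrib)
qed

text \<open>The folded factor \<open>2 * max y m\<close> splits at \<open>m\<close>: the tail gives
  the term with \<open>bessel_K (\<nu> + 1) m\<close>, and the part below is \<open>2 * m\<close>
  times the truncated moment of order 0, whose \<open>G_fun \<nu> \<nu> m\<close> consists of Struve
  functions. The tail integral requires \<open>m > 0\<close>, hence
  \<open>w \<noteq> 0\<close>.\<close>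

lemma has_bochner_integral_vg_kernel_abs:
  fixes w :: real
  assumes "w \<noteq> 0"
  defines "m \<equiv> \<bar>w\<bar>"
  shows "has_bochner_integral lborel (\<lambda>y. \<bar>y + w\<bar> * vg_kernel \<nu> y)
     (sqrt pi * 2 powr \<nu> * Gamma (\<nu> + 1 / 2) *
        (m\<^sup>2 * (bessel_K \<nu> m * struve_L (\<nu> - 1) m + bessel_K (\<nu> - 1) m * struve_L \<nu> m)
         + m powr (\<nu> + 1) * bessel_K (\<nu> + 1) m / (sqrt pi * 2 powr (\<nu> - 1) * Gamma (\<nu> + 1 / 2))))"
proof -
  have m: "m > 0" using assms by simp
  have "Gamma (\<nu> + 1 / 2) > 0" using \<nu> by (intro Gamma_real_pos) simp
  then have nz: "Gamma (\<nu> + 1 / 2) \<noteq> 0" by simp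
  let ?V = "sqrt pi * 2 powr \<nu> * Gamma (\<nu> + 1 / 2) *
        (m\<^sup>2 * (bessel_K \<nu> m * struve_L (\<nu> - 1) m + bessel_K (\<nu> - 1) m * struve_L \<nu> m)
         + m powr (\<nu> + 1) * bessel_K (\<nu> + 1) m / (sqrt pi * 2 powr (\<nu> - 1) * Gamma (\<nu> + 1 / 2)))"
  have "has_bochner_integral lborel
      (\<lambda>y. 2 * (indicator {m..} y * (y powr (\<nu> + 1) * bessel_K \<nu> y)) + 2 * m * (indicator {0<..<m} y * (y ^ 0 * vg_kernel \<nu> y)))
      (2 * (m powr (\<nu> + 1) * bessel_K (\<nu> + 1) m)
        + 2 * m * (2 powr (\<nu> + real 0 - 1) * Gamma_pair \<nu> (real 0) * G_fun (\<nu> + real 0) \<nu> m))"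
    using m by (intro has_bochner_integral_add has_bochner_integral_mult_right
        has_bochner_integral_powr_bessel_K_tail has_bochner_integral_vg_kernel_power_truncated) auto
  moreover have "2 * (indicator {m..} y * (y powr (\<nu> + 1) * bessel_K \<nu> y)) + 2 * m * (indicator {0<..<m} y * (y ^ 0 * vg_kernel \<nu> y))
      = indicator {0<..} y * ((\<bar>y + m\<bar> ^ 1 + \<bar>y - m\<bar> ^ 1) * vg_kernel \<nu> y)" for y
    using m by (cases "y \<le> 0"; cases "y < m") (auto simp: vg_kernel_def powr_add)
  moreover have "2 * (m powr (\<nu> + 1) * bessel_K (\<nu> + 1) m)
        + 2 * m * (2 powr (\<nu> + real 0 - 1) * Gamma_pair \<nu> (real 0) * G_fun (\<nu> + real 0) \<nu> m) = ?V"
  proof -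
    have "G_fun \<nu> \<nu> m = m * (bessel_K \<nu> m * struve_L (\<nu> - 1) m + bessel_K (\<nu> - 1) m * struve_L \<nu> m)"
      using m by (simp add: G_fun_def t_tilde_diagonal)
    moreover have "Gamma_pair \<nu> 0 = sqrt pi * Gamma (\<nu> + 1 / 2)"
      by (simp add: Gamma_pair_def Gamma_one_half_real)
    moreover have "2 powr \<nu> = 2 * 2 powr (\<nu> - 1)" by (simp add: powr_diff)
    ultimately show ?thesis using nz by (simp add: field_simps power2_eq_square)
  qed
  ultimately have "has_bochner_integral lborel (\<lambda>y. indicator {0<..} y * ((\<bar>y + \<bar>w\<bar>\<bar> ^ 1 + \<bar>y - \<bar>w\<bar>\<bar> ^ 1) * vg_kernel \<nu> y)) ?V"
    unfolding m_def[symmetric] by (simp only:)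
  from has_bochner_integral_vg_kernel_shift[OF this] show ?thesis by simp
qed

text \<open>By the triangle inequality \<open>J w\<close> differs from \<open>J 0\<close> by at most
  \<open>\<bar>w\<bar> * H\<close>, where \<open>H\<close> is the total mass of the kernel.\<close>

lemma vg_kernel_abs_tendsto:
  fixes J :: "real \<Rightarrow> real"
  assumes J: "\<And>w. has_bochner_integral lborel (\<lambda>y. \<bar>y + w\<bar> * vg_kernel \<nu> y) (J w)"
  shows "(J \<longlongrightarrow> J 0) (at 0)"
proof -
  obtain H where H: "has_bochner_integral lborel (vg_kernel \<nu>) H"
  proof -
    have "has_bochner_integral lborel (\<lambda>y. 2 * (indicator {0<..} y * (y ^ 0 * vg_kernel \<nu> y)))
      (2 * (2 powr (\<nu> + real 0 - 1) * Gamma_pair \<nu> (real 0)))"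
      by (intro has_bochner_integral_mult_right has_bochner_integral_vg_kernel_power)
    then have "has_bochner_integral lborel (\<lambda>y. indicator {0<..} y * (vg_kernel \<nu> y + vg_kernel \<nu> (- y)))
      (2 * (2 powr (\<nu> + real 0 - 1) * Gamma_pair \<nu> (real 0)))"
      by (rule has_bochner_integral_cong[THEN iffD1, rotated 3]) simp_all
    from has_bochner_integral_fold_even[OF this vg_kernel_nonneg] that show ?thesis by simp
  qed
  have upper: "J w \<le> J 0 + \<bar>w\<bar> * H" for w
  proof (rule has_bochner_integral_mono[OF J has_bochner_integral_add[OF J has_bochner_integral_mult_right[OF H]]])
    fix y
    have "\<bar>y + w\<bar> \<le> \<bar>y + 0\<bar> + \<bar>w\<bar>" by simp
    from mult_right_mono[OF this vg_kernel_nonneg]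
    show "\<bar>y + w\<bar> * vg_kernel \<nu> y \<le> \<bar>y + 0\<bar> * vg_kernel \<nu> y + \<bar>w\<bar> * vg_kernel \<nu> y"
      by (simp add: distrib_right)
  qed
  have lower: "J 0 - \<bar>w\<bar> * H \<le> J w" for w
  proof (rule has_bochner_integral_mono[OF has_bochner_integral_diff[OF J has_bochner_integral_mult_right[OF H]] J])
    fix y
    have "\<bar>y + 0\<bar> - \<bar>w\<bar> \<le> \<bar>y + w\<bar>" by simp
    from mult_right_mono[OF this vg_kernel_nonneg]
    show "\<bar>y + 0\<bar> * vg_kernel \<nu> y - \<bar>w\<bar> * vg_kernel \<nu> y \<le> \<bar>y + w\<bar> * vg_kernel \<nu> y"
      by (simp add: left_diff_distrib)
  qed
  have "((\<lambda>w. J 0 - \<bar>w\<bar> * H) \<longlongrightarrow> J 0) (at 0)" "((\<lambda>w. J 0 + \<bar>w\<bar> * H) \<longlongrightarrow> J 0) (at 0)"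
    by (auto intro!: tendsto_eq_intros)
  then show ?thesis
    by (intro tendsto_sandwich[of "\<lambda>w. J 0 - \<bar>w\<bar> * H" J _ "\<lambda>w. J 0 + \<bar>w\<bar> * H"]) (simp_all add: upper lower)
qed

text \<open>Substitute \<open>x = \<mu> + y / \<alpha>\<close>: the Jacobian cancels the factor
  \<open>\<alpha>\<close> of the density, and \<open>\<bar>x\<bar> ^ r\<close> contributes
  \<open>\<alpha> ^ r\<close> in the denominator.\<close>

lemma has_bochner_integral_VG_density:
  fixes I \<alpha> \<mu> :: real and r :: nat
  assumes \<alpha>: "\<alpha> > 0"
    and I: "has_bochner_integral lborel (\<lambda>y. \<bar>y + \<alpha> * \<mu>\<bar> ^ r * vg_kernel \<nu> y) I"
  shows "has_bochner_integral lborel (\<lambda>x. VG_density \<nu> \<alpha> 0 \<mu> x * \<bar>x\<bar> ^ r)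
           (I / (sqrt pi * 2 powr \<nu> * Gamma (\<nu> + 1 / 2) * \<alpha> ^ r))"
proof -
  define c where "c = sqrt pi * 2 powr \<nu> * Gamma (\<nu> + 1 / 2)"
  have "has_bochner_integral lborel (\<lambda>y. \<alpha> / (c * \<alpha> ^ r) * (\<bar>y + \<alpha> * \<mu>\<bar> ^ r * vg_kernel \<nu> y)) (\<alpha> / (c * \<alpha> ^ r) * I)"
    by (intro has_bochner_integral_mult_right I)
  moreover have "VG_density \<nu> \<alpha> 0 \<mu> (\<mu> + 1 / \<alpha> * y) * \<bar>\<mu> + 1 / \<alpha> * y\<bar> ^ r =
      \<alpha> / (c * \<alpha> ^ r) * (\<bar>y + \<alpha> * \<mu>\<bar> ^ r * vg_kernel \<nu> y)" for y
  proof -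
    have "\<mu> + 1 / \<alpha> * y = (y + \<alpha> * \<mu>) / \<alpha>" using \<alpha> by (simp add: field_simps)
    then have "\<bar>\<mu> + 1 / \<alpha> * y\<bar> ^ r = \<bar>y + \<alpha> * \<mu>\<bar> ^ r / \<alpha> ^ r"
      using \<alpha> by (simp add: power_divide)
    then show ?thesis
      using \<alpha> by (simp add: VG_density_eq_vg_kernel[OF \<alpha>] c_def)
  qed
  ultimately show ?thesis
    using \<alpha> by (subst lborel_has_bochner_integral_real_affine_iff[where c = "1 / \<alpha>" and t = \<mu>])
      (simp_all add: c_def)
qed

end

section \<open>Transfer to the random variable\<close>

lemma distributed_has_bochner_integral:
  fixes g :: "'b \<Rightarrow> real"
  assumes "distributed M N X (\<lambda>x. ennreal (f x))" "\<And>x. 0 \<le> f x" "g \<in> borel_measurable N"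
    and "has_bochner_integral N (\<lambda>x. f x * g x) I"
  shows "has_bochner_integral M (\<lambda>\<omega>. g (X \<omega>)) I"
  using assms distributed_integral[of M N X f g] distributed_integrable[of M N X f g]
  by (simp add: has_bochner_integral_iff)

theorem corollary2p5:
  fixes M :: "'a measure" and X :: "'a \<Rightarrow> real" and \<nu> \<alpha> \<mu> :: real
  assumes "prob_space M"
    and "\<nu> > - 1 / 2" and "\<alpha> > 0"
    and "distributed M lborel X (\<lambda>x. ennreal (VG_density \<nu> \<alpha> 0 \<mu> x))"
  shows "(\<forall>r::nat. odd r \<longrightarrow>
      integrable M (\<lambda>\<omega>. \<bar>X \<omega>\<bar> ^ r) \<and>
      prob_space.expectation M (\<lambda>\<omega>. \<bar>X \<omega>\<bar> ^ r) =
        2 ^ r / (sqrt pi * \<alpha> ^ r * Gamma (\<nu> + 1 / 2)) *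
        ((\<Sum>k = 0..(r - 1) div 2.
            real (r choose (2 * k)) * (\<alpha> * \<mu> / 2) ^ (2 * k)
            * Gamma ((real r - 2 * real k + 1) / 2) * Gamma (\<nu> + (real r - 2 * real k + 1) / 2))
         - (\<Sum>k = 0..r.
            real (r choose k) * (- 1) ^ k * (\<alpha> * \<bar>\<mu>\<bar> / 2) ^ k
            * Gamma ((real r - real k + 1) / 2) * Gamma (\<nu> + (real r - real k + 1) / 2)
            * G_fun (\<nu> + real r - real k) \<nu> (\<alpha> * \<bar>\<mu>\<bar>))))
    \<and>
    (let R = (\<lambda>m::real. 1 / \<alpha> *
          ((\<alpha> * m)\<^sup>2 * (bessel_K \<nu> (\<alpha> * \<bar>m\<bar>) * struve_L (\<nu> - 1) (\<alpha> * \<bar>m\<bar>)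
                      + bessel_K (\<nu> - 1) (\<alpha> * \<bar>m\<bar>) * struve_L \<nu> (\<alpha> * \<bar>m\<bar>))
           + (\<alpha> * \<bar>m\<bar>) powr (\<nu> + 1) * bessel_K (\<nu> + 1) (\<alpha> * \<bar>m\<bar>)
             / (sqrt pi * 2 powr (\<nu> - 1) * Gamma (\<nu> + 1 / 2))))
     in (\<mu> \<noteq> 0 \<longrightarrow> prob_space.expectation M (\<lambda>\<omega>. \<bar>X \<omega>\<bar>) = R \<mu>)
      \<and> (\<mu> = 0 \<longrightarrow> (R \<longlongrightarrow> prob_space.expectation M (\<lambda>\<omega>. \<bar>X \<omega>\<bar>)) (at 0)))"
proof -
  note \<nu> = assms(2) and \<alpha> = assms(3)
  define c where "c = sqrt pi * 2 powr \<nu> * Gamma (\<nu> + 1 / 2)"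
  have "Gamma (\<nu> + 1 / 2) > 0" using \<nu> by (intro Gamma_real_pos) simp
  then have c: "c > 0" by (simp add: c_def)
  have X: "has_bochner_integral M (\<lambda>\<omega>. \<bar>X \<omega>\<bar> ^ r) (I / (c * \<alpha> ^ r))"
    if "has_bochner_integral lborel (\<lambda>y. \<bar>y + \<alpha> * \<mu>\<bar> ^ r * vg_kernel \<nu> y) I" for I r
    unfolding c_def using that \<nu> \<alpha>
    by (intro distributed_has_bochner_integral[OF assms(4)] VG_density_nonneg has_bochner_integral_VG_density) auto
  have odd: "integrable M (\<lambda>\<omega>. \<bar>X \<omega>\<bar> ^ r) \<and>
      prob_space.expectation M (\<lambda>\<omega>. \<bar>X \<omega>\<bar> ^ r) =
        2 ^ r / (sqrt pi * \<alpha> ^ r * Gamma (\<nu> + 1 / 2)) *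
        ((\<Sum>k = 0..(r - 1) div 2.
            real (r choose (2 * k)) * (\<alpha> * \<mu> / 2) ^ (2 * k)
            * Gamma ((real r - 2 * real k + 1) / 2) * Gamma (\<nu> + (real r - 2 * real k + 1) / 2))
         - (\<Sum>k = 0..r.
            real (r choose k) * (- 1) ^ k * (\<alpha> * \<bar>\<mu>\<bar> / 2) ^ k
            * Gamma ((real r - real k + 1) / 2) * Gamma (\<nu> + (real r - real k + 1) / 2)
            * G_fun (\<nu> + real r - real k) \<nu> (\<alpha> * \<bar>\<mu>\<bar>)))"
    (is "_ \<and> _ = _ * (?A - ?B)") if r: "odd r" for r :: nat
  proof -
    have m: "\<bar>\<alpha> * \<mu>\<bar> = \<alpha> * \<bar>\<mu>\<bar>" using \<alpha> by (simp add: abs_mult)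
    have A: "(\<Sum>k = 0..(r - 1) div 2. real (r choose (2 * k)) * (\<bar>\<alpha> * \<mu>\<bar> / 2) ^ (2 * k) * Gamma_pair \<nu> (real (r - 2 * k))) = ?A"
    proof (rule sum.cong)
      fix k assume "k \<in> {0..(r - 1) div 2}"
      \<comment> \<open>Natural subtraction is exact here because
        \<open>2 * k \<le> r - 1\<close>.\<close>
      then have "real (r - 2 * k) = real r - 2 * real k" by auto
      moreover have "(\<bar>\<alpha> * \<mu>\<bar> / 2) ^ (2 * k) = (\<alpha> * \<mu> / 2) ^ (2 * k)"
        by (simp add: power_mult power_divide)
      ultimately show "real (r choose (2 * k)) * (\<bar>\<alpha> * \<mu>\<bar> / 2) ^ (2 * k) * Gamma_pair \<nu> (real (r - 2 * k)) =
          real (r choose (2 * k)) * (\<alpha> * \<mu> / 2) ^ (2 * k)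
            * Gamma ((real r - 2 * real k + 1) / 2) * Gamma (\<nu> + (real r - 2 * real k + 1) / 2)"
        by (simp only: Gamma_pair_def mult.assoc)
    qed simp
    have B: "(\<Sum>k = 0..r. real (r choose k) * (- 1) ^ k * (\<bar>\<alpha> * \<mu>\<bar> / 2) ^ k * Gamma_pair \<nu> (real (r - k)) * G_fun (\<nu> + real (r - k)) \<nu> \<bar>\<alpha> * \<mu>\<bar>) = ?B"
      unfolding m by (rule sum.cong) (simp_all add: Gamma_pair_def of_nat_diff add_diff_eq)
    from X[OF has_bochner_integral_vg_kernel_abs_odd[OF \<nu> r, of "\<alpha> * \<mu>"], unfolded A B]
    have "has_bochner_integral M (\<lambda>\<omega>. \<bar>X \<omega>\<bar> ^ r) (2 powr \<nu> * 2 ^ r * (?A - ?B) / (c * \<alpha> ^ r))" .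
    moreover have "2 powr \<nu> * 2 ^ r * D / (c * \<alpha> ^ r) = 2 ^ r / (sqrt pi * \<alpha> ^ r * Gamma (\<nu> + 1 / 2)) * D" for D
      by (simp add: c_def mult_ac)
    ultimately show ?thesis by (simp only: has_bochner_integral_iff)
  qed
  define R where "R = (\<lambda>m::real. 1 / \<alpha> *
          ((\<alpha> * m)\<^sup>2 * (bessel_K \<nu> (\<alpha> * \<bar>m\<bar>) * struve_L (\<nu> - 1) (\<alpha> * \<bar>m\<bar>)
                      + bessel_K (\<nu> - 1) (\<alpha> * \<bar>m\<bar>) * struve_L \<nu> (\<alpha> * \<bar>m\<bar>))
           + (\<alpha> * \<bar>m\<bar>) powr (\<nu> + 1) * bessel_K (\<nu> + 1) (\<alpha> * \<bar>m\<bar>)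
             / (sqrt pi * 2 powr (\<nu> - 1) * Gamma (\<nu> + 1 / 2))))"
  define J where "J w = (\<integral>y. \<bar>y + w\<bar> * vg_kernel \<nu> y \<partial>lborel)" for w
  have J: "has_bochner_integral lborel (\<lambda>y. \<bar>y + w\<bar> * vg_kernel \<nu> y) (J w)" for w
    \<comment> \<open>The odd case with \<open>r = 1\<close> covers every \<open>w\<close>,
      including 0, and provides the integrability.\<close>
    using has_bochner_integral_vg_kernel_abs_odd[OF \<nu>, of 1 w]
    unfolding J_def by (intro has_bochner_integral_integrable) (simp add: has_bochner_integral_iff)
  have E: "prob_space.expectation M (\<lambda>\<omega>. \<bar>X \<omega>\<bar>) = J (\<alpha> * \<mu>) / (c * \<alpha>)"
    using X[of 1 "J (\<alpha> * \<mu>)"] J by (simp add: has_bochner_integral_iff)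
  \<comment> \<open>Away from 0 the same integral is also evaluated by the Struve formula.\<close>
  have R: "R x = J (\<alpha> * x) / (c * \<alpha>)" if "x \<noteq> 0" for x
  proof -
    have "\<alpha> * x \<noteq> 0" using that \<alpha> by simp
    from has_bochner_integral_eq[OF J has_bochner_integral_vg_kernel_abs[OF \<nu> this]]
    have "J (\<alpha> * x) = c * (\<alpha> * R x)"
      using \<alpha> by (simp add: R_def c_def abs_mult power_mult_distrib)
    then show ?thesis using c \<alpha> by simp
  qed
  \<comment> \<open>By \<open>E\<close> the limit value is the expectation when
    \<open>\<mu> = 0\<close>. The limit is taken for \<open>J\<close>, which is continuous at 0, and
    passes to \<open>R\<close> since both sides of \<open>R\<close> agree on a punctured
    neighbourhood.\<close>
  have "(R \<longlongrightarrow> J 0 / (c * \<alpha>)) (at 0)"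
  proof (rule Lim_transform_eventually)
    have "((\<lambda>x. \<alpha> * x) \<longlongrightarrow> 0) (at 0)" by (auto intro!: tendsto_eq_intros)
    then have "filterlim (\<lambda>x. \<alpha> * x) (at 0) (at 0)"
      using \<alpha> by (auto simp: filterlim_at eventually_at_filter)
    from filterlim_compose[OF vg_kernel_abs_tendsto[OF \<nu> J] this]
    show "((\<lambda>x. J (\<alpha> * x) / (c * \<alpha>)) \<longlongrightarrow> J 0 / (c * \<alpha>)) (at 0)"
      by (intro tendsto_divide tendsto_const) (use c \<alpha> in auto)
    show "\<forall>\<^sub>F x in at 0. J (\<alpha> * x) / (c * \<alpha>) = R x"
      by (auto simp: eventually_at_filter R)
  qed
  then have "(\<mu> \<noteq> 0 \<longrightarrow> prob_space.expectation M (\<lambda>\<omega>. \<bar>X \<omega>\<bar>) = R \<mu>)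
      \<and> (\<mu> = 0 \<longrightarrow> (R \<longlongrightarrow> prob_space.expectation M (\<lambda>\<omega>. \<bar>X \<omega>\<bar>)) (at 0))"
    unfolding E by (auto simp: R)
  with odd show ?thesis
    unfolding R_def Let_def by blast
qed

end
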